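(* Let $2<p<\infty$, let $I$ be any infinite set and let $Y$ be a finite-dimensional real Banach space such that its dual $Y^*$ has modulus of convexity of power type $q$ for some $q$ with $2\leq q<p$. Then the norm of the projective tensor product $\ell_p(I)\widehat{\otimes}_\pi Y$ is SSD. Indeed, the dual space $(\ell_p(I)\widehat{\otimes}_\pi Y)^*$ has the $w^*$-Kadec-Klee property.
   Context: All Banach spaces are real. $B_X$ and $S_X$ denote the closed unit ball and unit sphere of $X$. SSD: the norm of $X$ is strongly subdifferentiable (SSD) at $x\in S_X$ if the one-sided limit $\lim_{t\to 0^+}\frac{\|x+th\|-1}{t}$ exists uniformly in $h\in S_X$. The norm of $X$ is SSD if it is SSD at every $x\in S_X$. Modulus of convexity: for $0<\varepsilon\leq 2$, $\delta_X(\varepsilon)=\inf\{1-\frac{\|x+y\|}{2}: x,y\in B_X,\ \|x-y\|\geq\varepsilon\}$. For $q\geq 2$, $X$ has modulus of convexity of power type $q$ if there is $C>0$ with $\delta_X(\varepsilon)\geq C\varepsilon^q$ for every $0<\varepsilon\le 2$. Projective tensor product: $X\widehat{\otimes}_\pi Y$ is the completion of the algebraic tensor product $X\otimes Y$ under the norm $\|z\|_\pi=\inf\{\sum_{n=1}^k\|x_n\|\|y_n\|: z=\sum_{n=1}^k x_n\otimes y_n\}$. Its dual is isometrically identified with the space $\mathcal L(X,Y^* )$ of bounded linear operators with the operator norm, $T\in\mathcal L(X,Y^* )$ acting by $T(x\otimes y)=T(x)(y)$. $w^*$-Kadec-Klee property: $X^*$ has the $w^*$-Kadec-Klee property if whenever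 a net $(x_s^* )$ in $S_{X^*}$ converges in the weak-star topology $\sigma(X^*,X)$ to some $x^*\in S_{X^*}$, then $\|x_s^*-x^*\|\to 0$. *)

theory Defs
  imports "HOL-Analysis.Analysis"
begin

section \<open>The space \<open>\<ell>\<^sub>p(I)\<close>\<close>

definition lp_space :: "real \<Rightarrow> 'i set \<Rightarrow> ('i \<Rightarrow> real) set" where
  "lp_space p I = {f. (\<forall>i. i \<notin> I \<longrightarrow> f i = 0) \<and> (\<lambda>i. \<bar>f i\<bar> powr p) summable_on I}"

definition lp_norm :: "real \<Rightarrow> 'i set \<Rightarrow> ('i \<Rightarrow> real) \<Rightarrow> real" where
  "lp_norm p I f = (\<Sum>\<^sub>\<infinity>i\<in>I. \<bar>f i\<bar> powr p) powr (1 / p)"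

text \<open>
  A HOL type cannot depend on the real number \<open>p\<close>. A Banach space type \<open>'x\<close> is therefore presented
  as \<open>\<ell>\<^sub>p(I)\<close> by its coordinates: \<open>coord\<close> is a linear isometry of \<open>'x\<close> onto
  \<open>(lp_space p I, lp_norm p I)\<close>, where the vector space operations on the latter are pointwise.
\<close>

definition is_lp_space :: "real \<Rightarrow> 'i set \<Rightarrow> ('x::real_normed_vector \<Rightarrow> 'i \<Rightarrow> real) \<Rightarrow> bool" where
  "is_lp_space p I coord \<longleftrightarrow>
     (\<forall>i. linear (\<lambda>x. coord x i)) \<and> bij_betw coord UNIV (lp_space p I) \<and>
     (\<forall>x. norm x = lp_norm p I (coord x))"


section \<open>Geometry of Banach spaces\<close>

definition finite_dimensional :: "'a::real_vector itself \<Rightarrow> bool" where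
  "finite_dimensional _ \<longleftrightarrow> (\<exists>B::'a set. finite B \<and> span B = UNIV)"

text \<open>
  The infimum is taken in the extended reals, so that it is \<open>\<infinity>\<close> for the zero space, where the
  set is empty (on type \<^typ>\<open>real\<close> the infimum of the empty set is unspecified).
\<close>

definition modulus_of_convexity :: "'a::real_normed_vector itself \<Rightarrow> real \<Rightarrow> ereal" where
  "modulus_of_convexity _ \<epsilon> =
     Inf {ereal (1 - norm (x + y) / 2) | x y :: 'a. x \<in> cball 0 1 \<and> y \<in> cball 0 1 \<and> norm (x - y) \<ge> \<epsilon>}"

definition convexity_of_power_type :: "'a::real_normed_vector itself \<Rightarrow> real \<Rightarrow> bool" where
  "convexity_of_power_type X q \<longleftrightarrow>
     (\<exists>C>0. \<forall>\<epsilon>. 0 < \<epsilon> \<and> \<epsilon> \<le> 2 \<longrightarrow> modulus_of_convexity X \<epsilon> \<ge> ereal (C * \<epsilon> powr q))"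

definition ssd_at :: "'a::real_normed_vector \<Rightarrow> bool" where
  "ssd_at x \<longleftrightarrow>
     (\<exists>d. uniform_limit (sphere 0 1) (\<lambda>t h. (norm (x + t *\<^sub>R h) - 1) / t) d (at_right 0))"

definition ssd_norm :: "'a::real_normed_vector itself \<Rightarrow> bool" where
  "ssd_norm _ \<longleftrightarrow> (\<forall>x\<in>sphere (0::'a) 1. ssd_at x)"

text \<open>
  For scalar-valued operators the strong operator topology, i.e. the topology of pointwise
  convergence on \<open>'a\<close>, is by definition the weak-star topology \<open>\<sigma>(X\<^sup>*, X)\<close>.
\<close>

abbreviation weak_star_topology :: "('a::real_normed_vector \<Rightarrow>\<^sub>L real) topology" where
  "weak_star_topology \<equiv> strong_operator_topology"

text \<open>
  The type argument is the predual; the property is one of its dual. Nets are rendered as filters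
  \<open>F\<close> on the dual: a net corresponds to the filter generated by its tails, and convergence of
  a net only depends on that filter.
\<close>

definition weak_star_kadec_klee :: "'a::real_normed_vector itself \<Rightarrow> bool" where
  "weak_star_kadec_klee _ \<longleftrightarrow>
     (\<forall>(F :: ('a \<Rightarrow>\<^sub>L real) filter) f.
        eventually (\<lambda>g. g \<in> sphere 0 1) F \<and> f \<in> sphere 0 1 \<and>
        limitin weak_star_topology (\<lambda>g. g) f F
        \<longrightarrow> ((\<lambda>g. norm (g - f)) \<longlongrightarrow> 0) F)"


section \<open>The algebraic tensor product\<close>

text \<open>
  A list \<open>[(x\<^sub>1, y\<^sub>1), \<dots>, (x\<^sub>k, y\<^sub>k)]\<close> stands for the formal sum of the \<open>x\<^sub>n \<otimes> y\<^sub>n\<close>. Two formal sums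
  denote the same tensor iff all bilinear forms agree on them, i.e. \<open>x \<otimes> y\<close> is identified with
  evaluation at \<open>(x, y)\<close> on the space of all (not only bounded) bilinear forms.
\<close>

definition tensor_rel :: "('x::real_vector \<times> 'y::real_vector) list \<Rightarrow> ('x \<times> 'y) list \<Rightarrow> bool" where
  "tensor_rel us vs \<longleftrightarrow>
     (\<forall>B::'x \<Rightarrow> 'y \<Rightarrow> real. bilinear B \<longrightarrow> (\<Sum>(x,y)\<leftarrow>us. B x y) = (\<Sum>(x,y)\<leftarrow>vs. B x y))"

lemma equivp_tensor_rel: "equivp tensor_rel"
  by (rule equivpI) (auto simp: reflp_def symp_def transp_def tensor_rel_def)

quotient_type (overloaded) ('x, 'y) alg_tensor = "('x::real_vector \<times> 'y::real_vector) list" / tensor_rel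
  by (rule equivp_tensor_rel)

lemma sum_list_scale:
  assumes "bilinear B"
  shows "(\<Sum>(x,y)\<leftarrow>map (\<lambda>(x,y). (r *\<^sub>R x, y)) us. B x y) = r *\<^sub>R (\<Sum>(x,y)\<leftarrow>us. B x y :: real)"
  by (induction us) (auto simp: bilinear_lmul[OF assms] algebra_simps)

lemma sum_list_uminus:
  assumes "bilinear B"
  shows "(\<Sum>(x,y)\<leftarrow>map (\<lambda>(x,y). (- x, y)) us. B x y) = - (\<Sum>(x,y)\<leftarrow>us. B x y :: real)"
  using sum_list_scale[OF assms, of "-1" us] by (simp del: map_map)

instantiation alg_tensor :: (real_vector, real_vector) real_vector
begin

lift_definition zero_alg_tensor :: "('a, 'b) alg_tensor" is "[]" .

lift_definition plus_alg_tensor :: "('a, 'b) alg_tensor \<Rightarrow> ('a, 'b) alg_tensor \<Rightarrow> ('a, 'b) alg_tensor"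
  is "(@)" by (simp add: tensor_rel_def)

lift_definition scaleR_alg_tensor :: "real \<Rightarrow> ('a, 'b) alg_tensor \<Rightarrow> ('a, 'b) alg_tensor"
  is "\<lambda>r. map (\<lambda>(x,y). (r *\<^sub>R x, y))"
  by (simp add: tensor_rel_def sum_list_scale del: map_map)

definition uminus_alg_tensor :: "('a, 'b) alg_tensor \<Rightarrow> ('a, 'b) alg_tensor" where
  "uminus_alg_tensor u = (-1) *\<^sub>R u"

definition minus_alg_tensor :: "('a, 'b) alg_tensor \<Rightarrow> ('a, 'b) alg_tensor \<Rightarrow> ('a, 'b) alg_tensor" where
  "minus_alg_tensor u v = u + (-1) *\<^sub>R v"

instance
proof
  fix a b c :: "('a, 'b) alg_tensor" and r s :: real
  show "a + b + c = a + (b + c)" by transfer (simp add: tensor_rel_def)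
  show "a + b = b + a" by transfer (simp add: tensor_rel_def)
  show "0 + a = a" by transfer (simp add: tensor_rel_def)
  show "- a + a = 0" unfolding uminus_alg_tensor_def
    by transfer
       (simp add: tensor_rel_def sum_list_scale sum_list_uminus del: map_map)
  show "a - b = a + - b" unfolding uminus_alg_tensor_def minus_alg_tensor_def ..
  show "r *\<^sub>R (a + b) = r *\<^sub>R a + r *\<^sub>R b"
    by transfer (simp add: tensor_rel_def)
  show "(r + s) *\<^sub>R a = r *\<^sub>R a + s *\<^sub>R a"
    by transfer (simp add: tensor_rel_def sum_list_scale distrib_right del: map_map)
  show "r *\<^sub>R s *\<^sub>R a = (r * s) *\<^sub>R a"
    by transfer (simp add: tensor_rel_def sum_list_scale mult.assoc del: map_map)
  show "1 *\<^sub>R a = a"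
    by transfer (simp add: tensor_rel_def sum_list_scale del: map_map)
qed

end

lift_definition tensor :: "'x::real_vector \<Rightarrow> 'y::real_vector \<Rightarrow> ('x, 'y) alg_tensor" (infixr "\<otimes>\<^sub>a" 75)
  is "\<lambda>x y. [(x, y)]" .

lemma tensor_bilinear: "bilinear (\<otimes>\<^sub>a)"
  unfolding bilinear_def linear_iff
  by (intro allI conjI; transfer)
     (auto simp: tensor_rel_def bilinear_ladd bilinear_radd bilinear_lmul bilinear_rmul)

lemma abs_alg_tensor_eq_sum: "abs_alg_tensor us = (\<Sum>(x,y)\<leftarrow>us. x \<otimes>\<^sub>a y)"
proof (induction us)
  case Nil
  show ?case by (simp add: zero_alg_tensor.abs_eq)
next
  case (Cons u us)
  obtain x y where "u = (x, y)" by force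
  then show ?case
    using plus_alg_tensor.abs_eq[of "[(x, y)]" us] Cons by (simp add: tensor.abs_eq)
qed

lemma alg_tensor_representation: "\<exists>us. z = (\<Sum>(x,y)\<leftarrow>us. x \<otimes>\<^sub>a y)"
  using abs_alg_tensor_eq_sum[of "rep_alg_tensor z"] Quotient3_abs_rep[OF Quotient3_alg_tensor]
  by metis

lifting_update alg_tensor.lifting
lifting_forget alg_tensor.lifting


section \<open>The projective norm\<close>

definition proj_norm :: "('x::real_normed_vector, 'y::real_normed_vector) alg_tensor \<Rightarrow> real" where
  "proj_norm z = Inf {(\<Sum>(x,y)\<leftarrow>us. norm x * norm y) | us. z = (\<Sum>(x,y)\<leftarrow>us. x \<otimes>\<^sub>a y)}"

lemma cost_nonneg: "0 \<le> (\<Sum>(x,y)\<leftarrow>us. norm x * norm y)"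
  by (rule sum_list_nonneg) auto

lemma proj_norm_le: "z = (\<Sum>(x,y)\<leftarrow>us. x \<otimes>\<^sub>a y) \<Longrightarrow> proj_norm z \<le> (\<Sum>(x,y)\<leftarrow>us. norm x * norm y)"
  unfolding proj_norm_def by (rule cInf_lower) (auto intro!: bdd_belowI[of _ 0] cost_nonneg)

lemma proj_norm_nonneg: "0 \<le> proj_norm z"
  unfolding proj_norm_def
  using alg_tensor_representation[of z] by (intro cInf_greatest) (auto intro: cost_nonneg)

lemma proj_norm_approx:
  assumes "e > 0"
  obtains us where "z = (\<Sum>(x,y)\<leftarrow>us. x \<otimes>\<^sub>a y)" "(\<Sum>(x,y)\<leftarrow>us. norm x * norm y) < proj_norm z + e"
proof -
  let ?S = "{(\<Sum>(x,y)\<leftarrow>us. norm x * norm y) | us. z = (\<Sum>(x,y)\<leftarrow>us. x \<otimes>\<^sub>a y)}"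
  have "?S \<noteq> {}" using alg_tensor_representation[of z] by auto
  moreover have "Inf ?S < proj_norm z + e" using assms by (simp add: proj_norm_def)
  ultimately obtain c where "c \<in> ?S" "c < proj_norm z + e" by (rule cInf_lessD[THEN bexE])
  then show thesis using that by auto
qed

lemma proj_norm_zero [simp]: "proj_norm 0 = 0"
  by (rule antisym) (use proj_norm_le[of 0 "[]"] proj_norm_nonneg in auto)

lemma proj_norm_triangle: "proj_norm (a + b) \<le> proj_norm a + proj_norm b"
proof (rule field_le_epsilon)
  fix e :: real assume "e > 0"
  obtain us where us: "a = (\<Sum>(x,y)\<leftarrow>us. x \<otimes>\<^sub>a y)" "(\<Sum>(x,y)\<leftarrow>us. norm x * norm y) < proj_norm a + e/2"
    using proj_norm_approx[of "e/2" a] \<open>e > 0\<close> by auto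
  obtain vs where vs: "b = (\<Sum>(x,y)\<leftarrow>vs. x \<otimes>\<^sub>a y)" "(\<Sum>(x,y)\<leftarrow>vs. norm x * norm y) < proj_norm b + e/2"
    using proj_norm_approx[of "e/2" b] \<open>e > 0\<close> by auto
  show "proj_norm (a + b) \<le> proj_norm a + proj_norm b + e"
    using proj_norm_le[of "a + b" "us @ vs"] us vs by simp
qed

lemma proj_norm_scaleR: "proj_norm (r *\<^sub>R a) = \<bar>r\<bar> * proj_norm a"
proof -
  have le: "proj_norm (r *\<^sub>R a) \<le> \<bar>r\<bar> * proj_norm a" for r and a :: "('a, 'b) alg_tensor"
  proof (cases "r = 0")
    case False
    show ?thesis
    proof (rule field_le_epsilon)
      fix e :: real assume "e > 0"
      obtain us where us: "a = (\<Sum>(x,y)\<leftarrow>us. x \<otimes>\<^sub>a y)"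
        "(\<Sum>(x,y)\<leftarrow>us. norm x * norm y) < proj_norm a + e / \<bar>r\<bar>"
        using proj_norm_approx[of "e / \<bar>r\<bar>" a] \<open>e > 0\<close> False by auto
      let ?vs = "map (\<lambda>(x,y). (r *\<^sub>R x, y)) us"
      have "r *\<^sub>R (\<Sum>(x,y)\<leftarrow>us. x \<otimes>\<^sub>a y) = (\<Sum>(x,y)\<leftarrow>?vs. x \<otimes>\<^sub>a y)"
        by (induction us) (auto simp: scaleR_add_right bilinear_lmul[OF tensor_bilinear])
      then have "proj_norm (r *\<^sub>R a) \<le> (\<Sum>(x,y)\<leftarrow>?vs. norm x * norm y)"
        using us(1) by (intro proj_norm_le) simp
      also have "\<dots> = \<bar>r\<bar> * (\<Sum>(x,y)\<leftarrow>us. norm x * norm y)"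
        by (induction us) (auto simp: algebra_simps)
      also have "\<dots> \<le> \<bar>r\<bar> * (proj_norm a + e / \<bar>r\<bar>)"
        using us(2) by (intro mult_left_mono) auto
      also have "\<dots> = \<bar>r\<bar> * proj_norm a + e" using False by (simp add: field_simps)
      finally show "proj_norm (r *\<^sub>R a) \<le> \<bar>r\<bar> * proj_norm a + e" .
    qed
  qed simp
  show ?thesis
  proof (cases "r = 0")
    case False
    have "proj_norm a \<le> \<bar>inverse r\<bar> * proj_norm (r *\<^sub>R a)"
      using le[of "inverse r" "r *\<^sub>R a"] False by simp
    then have "\<bar>r\<bar> * proj_norm a \<le> proj_norm (r *\<^sub>R a)"
      using False by (simp add: field_simps abs_inverse)
    then show ?thesis using le[of r a] by simp
  qed simp
qed

lemma proj_norm_uminus [simp]: "proj_norm (- a) = proj_norm a"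
  using proj_norm_scaleR[of "-1" a] by simp

lemma proj_norm_minus_commute: "proj_norm (a - b) = proj_norm (b - a)"
  using proj_norm_uminus[of "a - b"] by simp

lemma proj_norm_diff_triangle: "proj_norm (a - c) \<le> proj_norm (a - b) + proj_norm (b - c)"
  using proj_norm_triangle[of "a - b" "b - c"] by simp

lemma proj_norm_diff_diff_le:
  "proj_norm ((a + b) - (c + d)) \<le> proj_norm (a - c) + proj_norm (b - d)"
  using proj_norm_triangle[of "a - c" "b - d"] by (simp add: algebra_simps)

lemma proj_norm_abs_diff: "\<bar>proj_norm a - proj_norm b\<bar> \<le> proj_norm (a - b)"
  using proj_norm_triangle[of "a - b" b] proj_norm_triangle[of "b - a" a]
  by (simp add: proj_norm_minus_commute[of b a] abs_le_iff)


section \<open>The projective tensor product\<close>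

text \<open>
  The completion of the algebraic tensor product under \<^const>\<open>proj_norm\<close>: Cauchy sequences of
  tensors modulo sequences converging to 0, normed by the limit of the norms.
\<close>

definition proj_Cauchy :: "(nat \<Rightarrow> ('x::real_normed_vector, 'y::real_normed_vector) alg_tensor) \<Rightarrow> bool" where
  "proj_Cauchy u \<longleftrightarrow> (\<forall>e>0. \<exists>N. \<forall>m\<ge>N. \<forall>n\<ge>N. proj_norm (u m - u n) < e)"

definition proj_rel :: "(nat \<Rightarrow> ('x::real_normed_vector, 'y::real_normed_vector) alg_tensor) \<Rightarrow>
    (nat \<Rightarrow> ('x, 'y) alg_tensor) \<Rightarrow> bool" where
  "proj_rel u v \<longleftrightarrow> proj_Cauchy u \<and> proj_Cauchy v \<and> (\<lambda>n. proj_norm (u n - v n)) \<longlonglongrightarrow> 0"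

lemma proj_Cauchy_const [simp]: "proj_Cauchy (\<lambda>n. z)"
  by (simp add: proj_Cauchy_def)

lemma proj_Cauchy_add:
  assumes "proj_Cauchy u" "proj_Cauchy v"
  shows "proj_Cauchy (\<lambda>n. u n + v n)"
  unfolding proj_Cauchy_def
proof (intro allI impI)
  fix e :: real assume "e > 0"
  then have "e / 2 > 0" by simp
  then obtain M N where
    M: "\<forall>m\<ge>M. \<forall>n\<ge>M. proj_norm (u m - u n) < e / 2" and
    N: "\<forall>m\<ge>N. \<forall>n\<ge>N. proj_norm (v m - v n) < e / 2"
    using assms unfolding proj_Cauchy_def by blast
  show "\<exists>N. \<forall>m\<ge>N. \<forall>n\<ge>N. proj_norm ((u m + v m) - (u n + v n)) < e"
  proof (intro exI[of _ "max M N"] allI impI)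
    fix m n assume "max M N \<le> m" "max M N \<le> n"
    then have "proj_norm (u m - u n) < e / 2" "proj_norm (v m - v n) < e / 2"
      using M N by auto
    then show "proj_norm ((u m + v m) - (u n + v n)) < e"
      using proj_norm_diff_diff_le[of "u m" "v m" "u n" "v n"] by linarith
  qed
qed

lemma proj_Cauchy_scaleR:
  assumes "proj_Cauchy u"
  shows "proj_Cauchy (\<lambda>n. r *\<^sub>R u n)"
  unfolding proj_Cauchy_def
proof (intro allI impI)
  fix e :: real assume "e > 0"
  then have "e / (\<bar>r\<bar> + 1) > 0" by (simp add: add_nonneg_pos)
  then obtain N where N: "\<forall>m\<ge>N. \<forall>n\<ge>N. proj_norm (u m - u n) < e / (\<bar>r\<bar> + 1)"
    using assms unfolding proj_Cauchy_def by blast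
  show "\<exists>N. \<forall>m\<ge>N. \<forall>n\<ge>N. proj_norm (r *\<^sub>R u m - r *\<^sub>R u n) < e"
  proof (intro exI[of _ N] allI impI)
    fix m n assume "N \<le> m" "N \<le> n"
    then have "proj_norm (u m - u n) < e / (\<bar>r\<bar> + 1)" using N by auto
    then have "(\<bar>r\<bar> + 1) * proj_norm (u m - u n) < e"
      by (simp add: field_simps)
    moreover have "proj_norm (r *\<^sub>R u m - r *\<^sub>R u n) = \<bar>r\<bar> * proj_norm (u m - u n)"
      by (metis proj_norm_scaleR scaleR_diff_right)
    ultimately show "proj_norm (r *\<^sub>R u m - r *\<^sub>R u n) < e"
      using proj_norm_nonneg[of "u m - u n"] by (simp add: algebra_simps)
  qed
qed

lemma proj_Cauchy_norm_convergent:
  assumes "proj_Cauchy u"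
  shows "convergent (\<lambda>n. proj_norm (u n))"
proof -
  have "Cauchy (\<lambda>n. proj_norm (u n))"
    unfolding Cauchy_def
  proof (intro allI impI)
    fix e :: real assume "e > 0"
    then obtain N where "\<forall>m\<ge>N. \<forall>n\<ge>N. proj_norm (u m - u n) < e"
      using assms unfolding proj_Cauchy_def by blast
    then show "\<exists>N. \<forall>m\<ge>N. \<forall>n\<ge>N. dist (proj_norm (u m)) (proj_norm (u n)) < e"
      unfolding dist_real_def by (meson proj_norm_abs_diff le_less_trans)
  qed
  then show ?thesis by (rule Cauchy_convergent)
qed

lemma proj_rel_refl: "proj_Cauchy u \<Longrightarrow> proj_rel u u"
  by (simp add: proj_rel_def)

lemma proj_rel_trans:
  assumes "proj_rel u v" "proj_rel v w"
  shows "proj_rel u w"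
proof -
  have "(\<lambda>n. proj_norm (u n - v n) + proj_norm (v n - w n)) \<longlonglongrightarrow> 0"
    using assms by (intro tendsto_add_zero) (auto simp: proj_rel_def)
  then have "(\<lambda>n. proj_norm (u n - w n)) \<longlonglongrightarrow> 0"
    by (rule Lim_null_comparison[rotated])
       (simp add: proj_norm_nonneg proj_norm_diff_triangle)
  with assms show ?thesis by (simp add: proj_rel_def)
qed

lemma part_equivp_proj_rel: "part_equivp proj_rel"
proof (rule part_equivpI)
  show "\<exists>u. proj_rel u u" by (rule exI[of _ "\<lambda>n. 0"]) (simp add: proj_rel_refl)
  show "symp proj_rel" by (rule sympI) (simp add: proj_rel_def proj_norm_minus_commute)
  show "transp proj_rel" by (rule transpI) (rule proj_rel_trans)
qed

quotient_type (overloaded) ('x, 'y) proj_tensor =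
    "nat \<Rightarrow> ('x::real_normed_vector, 'y::real_normed_vector) alg_tensor" / partial: proj_rel
  by (rule part_equivp_proj_rel)

lemma proj_rel_norm_lim:
  assumes "proj_rel u v"
  shows "lim (\<lambda>n. proj_norm (u n)) = lim (\<lambda>n. proj_norm (v n))"
proof -
  have "(\<lambda>n. proj_norm (u n - v n)) \<longlonglongrightarrow> 0" using assms by (simp add: proj_rel_def)
  then have "(\<lambda>n. proj_norm (u n) - proj_norm (v n)) \<longlonglongrightarrow> 0"
    by (rule Lim_null_comparison[rotated]) (simp add: proj_norm_abs_diff)
  moreover have "(\<lambda>n. proj_norm (u n)) \<longlonglongrightarrow> lim (\<lambda>n. proj_norm (u n))"
    using assms proj_Cauchy_norm_convergent by (auto simp: proj_rel_def convergent_LIMSEQ_iff)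
  moreover have "(\<lambda>n. proj_norm (v n)) \<longlonglongrightarrow> lim (\<lambda>n. proj_norm (v n))"
    using assms proj_Cauchy_norm_convergent by (auto simp: proj_rel_def convergent_LIMSEQ_iff)
  ultimately show ?thesis
    using LIMSEQ_unique tendsto_diff by fastforce
qed

lemma proj_rel_add:
  assumes "proj_rel u u'" "proj_rel v v'"
  shows "proj_rel (\<lambda>n. u n + v n) (\<lambda>n. u' n + v' n)"
proof -
  have "(\<lambda>n. proj_norm (u n - u' n) + proj_norm (v n - v' n)) \<longlonglongrightarrow> 0"
    using assms by (intro tendsto_add_zero) (auto simp: proj_rel_def)
  then have "(\<lambda>n. proj_norm ((u n + v n) - (u' n + v' n))) \<longlonglongrightarrow> 0"
    by (rule Lim_null_comparison[rotated])
       (simp add: proj_norm_nonneg proj_norm_diff_diff_le)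
  with assms show ?thesis by (simp add: proj_rel_def proj_Cauchy_add)
qed

lemma proj_rel_scaleR:
  assumes "proj_rel u u'"
  shows "proj_rel (\<lambda>n. r *\<^sub>R u n) (\<lambda>n. r *\<^sub>R u' n)"
proof -
  have "(\<lambda>n. \<bar>r\<bar> * proj_norm (u n - u' n)) \<longlonglongrightarrow> \<bar>r\<bar> * 0"
    using assms by (intro tendsto_mult_left) (auto simp: proj_rel_def)
  moreover have "proj_norm (r *\<^sub>R u n - r *\<^sub>R u' n) = \<bar>r\<bar> * proj_norm (u n - u' n)" for n
    by (metis proj_norm_scaleR scaleR_diff_right)
  ultimately show ?thesis using assms by (simp add: proj_rel_def proj_Cauchy_scaleR)
qed

instantiation proj_tensor :: (real_normed_vector, real_normed_vector) real_normed_vector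
begin

lift_definition zero_proj_tensor :: "('a, 'b) proj_tensor" is "\<lambda>n. 0"
  by (simp add: proj_rel_refl)

lift_definition plus_proj_tensor :: "('a, 'b) proj_tensor \<Rightarrow> ('a, 'b) proj_tensor \<Rightarrow> ('a, 'b) proj_tensor"
  is "\<lambda>u v n. u n + v n" by (rule proj_rel_add)

lift_definition scaleR_proj_tensor :: "real \<Rightarrow> ('a, 'b) proj_tensor \<Rightarrow> ('a, 'b) proj_tensor"
  is "\<lambda>r u n. r *\<^sub>R u n" by (rule proj_rel_scaleR)

definition uminus_proj_tensor :: "('a, 'b) proj_tensor \<Rightarrow> ('a, 'b) proj_tensor" where
  "uminus_proj_tensor z = (-1) *\<^sub>R z"

definition minus_proj_tensor :: "('a, 'b) proj_tensor \<Rightarrow> ('a, 'b) proj_tensor \<Rightarrow> ('a, 'b) proj_tensor" where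
  "minus_proj_tensor z w = z + (-1) *\<^sub>R w"

lift_definition norm_proj_tensor :: "('a, 'b) proj_tensor \<Rightarrow> real"
  is "\<lambda>u. lim (\<lambda>n. proj_norm (u n))" by (rule proj_rel_norm_lim)

definition dist_proj_tensor :: "('a, 'b) proj_tensor \<Rightarrow> ('a, 'b) proj_tensor \<Rightarrow> real" where
  "dist_proj_tensor z w = norm (z - w)"

definition [code del]: "(uniformity :: (('a, 'b) proj_tensor \<times> ('a, 'b) proj_tensor) filter) =
  (INF e\<in>{0<..}. principal {(x, y). dist x y < e})"

definition open_proj_tensor :: "('a, 'b) proj_tensor set \<Rightarrow> bool" where
  [code del]: "open_proj_tensor S = (\<forall>x\<in>S. \<forall>\<^sub>F (x', y) in uniformity. x' = x \<longrightarrow> y \<in> S)"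

definition sgn_proj_tensor :: "('a, 'b) proj_tensor \<Rightarrow> ('a, 'b) proj_tensor" where
  "sgn_proj_tensor z = inverse (norm z) *\<^sub>R z"

instance
proof
  fix a b c :: "('a, 'b) proj_tensor" and r s :: real
  show "a + b + c = a + (b + c)"
    by transfer (simp add: proj_rel_def proj_Cauchy_add add.assoc)
  show "a + b = b + a"
    by transfer (simp add: proj_rel_def proj_Cauchy_add add.commute)
  show "0 + a = a" by transfer (simp add: proj_rel_def)
  show "- a + a = 0" unfolding uminus_proj_tensor_def
    by transfer (simp add: proj_rel_def)
  show "a - b = a + - b" unfolding uminus_proj_tensor_def minus_proj_tensor_def ..
  show "r *\<^sub>R (a + b) = r *\<^sub>R a + r *\<^sub>R b"
    by transfer (simp add: proj_rel_def proj_Cauchy_add proj_Cauchy_scaleR scaleR_add_right)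
  show "(r + s) *\<^sub>R a = r *\<^sub>R a + s *\<^sub>R a"
    by transfer (simp add: proj_rel_def proj_Cauchy_add proj_Cauchy_scaleR scaleR_add_left)
  show "r *\<^sub>R s *\<^sub>R a = (r * s) *\<^sub>R a"
    by transfer (simp add: proj_rel_def proj_Cauchy_scaleR)
  show "1 *\<^sub>R a = a" by transfer (simp add: proj_rel_def)
  show "dist a b = norm (a - b)" by (rule dist_proj_tensor_def)
  show "sgn a = inverse (norm a) *\<^sub>R a" by (rule sgn_proj_tensor_def)
  show "(uniformity :: (('a, 'b) proj_tensor \<times> ('a, 'b) proj_tensor) filter) =
      (INF e\<in>{0<..}. principal {(x, y). dist x y < e})"
    by (rule uniformity_proj_tensor_def)
  show "open S = (\<forall>x\<in>S. \<forall>\<^sub>F (x', y) in uniformity. x' = x \<longrightarrow> y \<in> S)"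
    for S :: "('a, 'b) proj_tensor set"
    by (rule open_proj_tensor_def)
  show "norm a = 0 \<longleftrightarrow> a = 0"
  proof transfer
    fix u :: "nat \<Rightarrow> ('a, 'b) alg_tensor"
    assume "proj_rel u u"
    then have u: "proj_Cauchy u" by (simp add: proj_rel_def)
    then have "(\<lambda>n. proj_norm (u n)) \<longlonglongrightarrow> lim (\<lambda>n. proj_norm (u n))"
      using proj_Cauchy_norm_convergent convergent_LIMSEQ_iff by blast
    then have "lim (\<lambda>n. proj_norm (u n)) = 0 \<longleftrightarrow> (\<lambda>n. proj_norm (u n)) \<longlonglongrightarrow> 0"
      by (metis LIMSEQ_unique)
    with u show "lim (\<lambda>n. proj_norm (u n)) = 0 \<longleftrightarrow> proj_rel u (\<lambda>n. 0)"
      by (simp add: proj_rel_def)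
  qed
  show "norm (a + b) \<le> norm a + norm b"
  proof transfer
    fix u v :: "nat \<Rightarrow> ('a, 'b) alg_tensor"
    assume "proj_rel u u" "proj_rel v v"
    then have "proj_Cauchy u" "proj_Cauchy v" by (auto simp: proj_rel_def)
    then have "(\<lambda>n. proj_norm (u n)) \<longlonglongrightarrow> lim (\<lambda>n. proj_norm (u n))"
      "(\<lambda>n. proj_norm (v n)) \<longlonglongrightarrow> lim (\<lambda>n. proj_norm (v n))"
      "(\<lambda>n. proj_norm (u n + v n)) \<longlonglongrightarrow> lim (\<lambda>n. proj_norm (u n + v n))"
      using proj_Cauchy_norm_convergent proj_Cauchy_add convergent_LIMSEQ_iff by blast+
    then show "lim (\<lambda>n. proj_norm (u n + v n)) \<le> lim (\<lambda>n. proj_norm (u n)) + lim (\<lambda>n. proj_norm (v n))"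
      by (intro LIMSEQ_le[OF _ tendsto_add]) (auto simp: proj_norm_triangle)
  qed
  show "norm (r *\<^sub>R a) = \<bar>r\<bar> * norm a"
  proof transfer
    fix r :: real and u :: "nat \<Rightarrow> ('a, 'b) alg_tensor"
    assume "proj_rel u u"
    then have "proj_Cauchy u" by (auto simp: proj_rel_def)
    then have "(\<lambda>n. proj_norm (u n)) \<longlonglongrightarrow> lim (\<lambda>n. proj_norm (u n))"
      using proj_Cauchy_norm_convergent convergent_LIMSEQ_iff by blast
    then show "lim (\<lambda>n. proj_norm (r *\<^sub>R u n)) = \<bar>r\<bar> * lim (\<lambda>n. proj_norm (u n))"
      by (intro limI) (simp add: proj_norm_scaleR tendsto_mult_left)
  qed
qed

end

lift_definition of_alg_tensor ::
    "('x::real_normed_vector, 'y::real_normed_vector) alg_tensor \<Rightarrow> ('x, 'y) proj_tensor"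
  is "\<lambda>z n. z" by (simp add: proj_rel_refl)

lemma linear_of_alg_tensor: "linear of_alg_tensor"
  unfolding linear_iff by (intro conjI allI; transfer) (simp_all add: proj_rel_refl)

lemma norm_of_alg_tensor: "norm (of_alg_tensor z) = proj_norm z"
  by transfer simp

lemma of_alg_tensor_dense:
  assumes "e > 0"
  shows "\<exists>w. norm (z - of_alg_tensor w) < e"
proof -
  have "\<exists>w. norm (z + (-1) *\<^sub>R of_alg_tensor w) < e"
    using assms
  proof transfer
    fix e :: real and u :: "nat \<Rightarrow> ('a, 'b) alg_tensor"
    assume "proj_rel u u" "0 < e"
    then have u: "proj_Cauchy u" by (simp add: proj_rel_def)
    then obtain N where N: "\<forall>m\<ge>N. \<forall>n\<ge>N. proj_norm (u m - u n) < e / 2"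
      using \<open>0 < e\<close> unfolding proj_Cauchy_def by (meson half_gt_zero)
    have "proj_Cauchy (\<lambda>n. u n + (-1) *\<^sub>R u N)"
      using u by (intro proj_Cauchy_add) auto
    then have "(\<lambda>n. proj_norm (u n + (-1) *\<^sub>R u N)) \<longlonglongrightarrow> lim (\<lambda>n. proj_norm (u n + (-1) *\<^sub>R u N))"
      using proj_Cauchy_norm_convergent convergent_LIMSEQ_iff by blast
    moreover have "proj_norm (u n + (-1) *\<^sub>R u N) \<le> e / 2" if "n \<ge> N" for n
      using N that by (simp add: less_imp_le)
    ultimately have "lim (\<lambda>n. proj_norm (u n + (-1) *\<^sub>R u N)) \<le> e / 2"
      by (intro LIMSEQ_le_const2) auto
    then show "\<exists>w. lim (\<lambda>n. proj_norm (u n + (-1) *\<^sub>R w)) < e"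
      using \<open>0 < e\<close> by (intro exI[of _ "u N"]) linarith
  qed
  then show ?thesis by simp
qed

lemma of_alg_tensor_Cauchy_convergent:
  assumes "proj_Cauchy u"
  shows "\<exists>z. (\<lambda>n. of_alg_tensor (u n)) \<longlonglongrightarrow> z"
proof -
  have rel: "proj_rel u u" using assms by (rule proj_rel_refl)
  let ?z = "abs_proj_tensor u"
  have bound: "norm (of_alg_tensor w - ?z) \<le> d"
    if "\<forall>n\<ge>N. proj_norm (w - u n) \<le> d" for w d N
  proof -
    have "of_alg_tensor w - ?z = abs_proj_tensor (\<lambda>n. w + (-1) *\<^sub>R u n)"
      unfolding minus_proj_tensor_def of_alg_tensor_def map_fun_def comp_def id_def
        scaleR_proj_tensor.abs_eq[OF rel]
      by (rule plus_proj_tensor.abs_eq[OF proj_rel_refl[OF proj_Cauchy_const] proj_rel_scaleR[OF rel]])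
    moreover have c: "proj_Cauchy (\<lambda>n. w + (-1) *\<^sub>R u n)"
      by (rule proj_Cauchy_add[OF proj_Cauchy_const proj_Cauchy_scaleR[OF assms]])
    ultimately have "norm (of_alg_tensor w - ?z) = lim (\<lambda>n. proj_norm (w + (-1) *\<^sub>R u n))"
      using norm_proj_tensor.abs_eq[OF proj_rel_refl[OF c]] by (simp only:)
    moreover have "(\<lambda>n. proj_norm (w + (-1) *\<^sub>R u n)) \<longlonglongrightarrow> lim (\<lambda>n. proj_norm (w + (-1) *\<^sub>R u n))"
      using c proj_Cauchy_norm_convergent convergent_LIMSEQ_iff by blast
    moreover have "\<exists>N. \<forall>n\<ge>N. proj_norm (w + (-1) *\<^sub>R u n) \<le> d"
      using that by auto
    ultimately show ?thesis using LIMSEQ_le_const2 by (simp only:)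
  qed
  have "(\<lambda>n. of_alg_tensor (u n)) \<longlonglongrightarrow> ?z"
  proof (rule LIMSEQ_I)
    fix e :: real assume "0 < e"
    then obtain N where N: "\<forall>m\<ge>N. \<forall>n\<ge>N. proj_norm (u m - u n) < e / 2"
      using assms unfolding proj_Cauchy_def by (meson half_gt_zero)
    show "\<exists>N. \<forall>n\<ge>N. norm (of_alg_tensor (u n) - ?z) < e"
    proof (intro exI[of _ N] allI impI)
      fix m assume "m \<ge> N"
      then have "norm (of_alg_tensor (u m) - ?z) \<le> e / 2"
        using N by (intro bound[of N]) (meson less_imp_le)
      then show "norm (of_alg_tensor (u m) - ?z) < e" using \<open>0 < e\<close> by linarith
    qed
  qed
  then show ?thesis by blast
qed

instance proj_tensor :: (real_normed_vector, real_normed_vector) banach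
proof
  fix Z :: "nat \<Rightarrow> ('a, 'b) proj_tensor"
  assume Z: "Cauchy Z"
  have "\<forall>n. \<exists>w. norm (Z n - of_alg_tensor w) < inverse (real (Suc n))"
    by (intro allI of_alg_tensor_dense) simp
  then obtain u where u: "\<And>n. norm (Z n - of_alg_tensor (u n)) < inverse (real (Suc n))"
    by metis
  have lim0: "(\<lambda>n. Z n - of_alg_tensor (u n)) \<longlonglongrightarrow> 0"
    using u by (intro Lim_null_comparison[OF _ LIMSEQ_inverse_real_of_nat] always_eventually allI less_imp_le)
  have "proj_Cauchy u"
    unfolding proj_Cauchy_def
  proof (intro allI impI)
    fix e :: real assume "0 < e"
    then have e: "0 < e / 3" by simp
    obtain M where M: "norm (Z m - Z n) < e / 3" if "m \<ge> M" "n \<ge> M" for m n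
      using Z e unfolding Cauchy_iff by meson
    obtain N where N: "norm (Z n - of_alg_tensor (u n)) < e / 3" if "n \<ge> N" for n
      using LIMSEQ_D[OF lim0 e] by auto
    show "\<exists>N. \<forall>m\<ge>N. \<forall>n\<ge>N. proj_norm (u m - u n) < e"
    proof (intro exI[of _ "max M N"] allI impI)
      fix m n assume mn: "max M N \<le> m" "max M N \<le> n"
      have "proj_norm (u m - u n) = norm (of_alg_tensor (u m) - of_alg_tensor (u n))"
        by (simp add: norm_of_alg_tensor linear_diff[OF linear_of_alg_tensor, symmetric])
      also have "\<dots> = norm ((Z m - Z n) - (Z m - of_alg_tensor (u m)) + (Z n - of_alg_tensor (u n)))"
        by simp
      also have "\<dots> \<le> norm (Z m - Z n) + norm (Z m - of_alg_tensor (u m)) + norm (Z n - of_alg_tensor (u n))"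
        by (meson add_mono norm_triangle_ineq norm_triangle_ineq4 order_refl order_trans)
      also have "\<dots> < e" using M[of m n] N[of m] N[of n] mn by simp
      finally show "proj_norm (u m - u n) < e" .
    qed
  qed
  then obtain z where "(\<lambda>n. of_alg_tensor (u n)) \<longlonglongrightarrow> z"
    using of_alg_tensor_Cauchy_convergent by blast
  from tendsto_add[OF lim0 this] show "convergent Z"
    by (auto simp: convergent_def)
qed

end

theory Submission
  imports Defs
begin

text \<open>
  A functional on the projective tensor product is a bounded operator \<open>T\<close> from \<open>\<ell>\<^sub>p(I)\<close> into the dual \<open>Z\<close> of
  the second factor, with the operator norm (\<open>norm_operator_of\<close>). Because \<open>Z\<close> is the dual of a
  finite-dimensional space, weak-star convergence of functionals amounts to convergence of the operators,
  in norm, at each vector (\<open>tendsto_functional_if_pointwise\<close>).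

  The heart of the matter is a comparison of exponents. Vectors of \<open>\<ell>\<^sub>p\<close> with disjoint supports satisfy
  \<open>norm (x + t y) ^ p = norm x ^ p + t ^ p norm y ^ p\<close>, so adding a small disjoint piece to a unit vector costs only
  \<open>t ^ p\<close> in norm, whereas uniform convexity of power type \<open>q\<close> in \<open>Z\<close> makes a perturbation \<open>\<plusminus> t T y\<close> of
  \<open>T x\<close> gain something of order \<open>t ^ q\<close> for one of the signs. As \<open>q < p\<close>, the gain wins for small \<open>t\<close>; so an
  operator of norm at most 1 that almost attains norm 1 at \<open>x\<close> is small on everything disjoint from \<open>x\<close>
  (\<open>small_off_support_of_norming_vector\<close>). Now let unit operators \<open>R s\<close> converge pointwise to a unit operator
  \<open>T\<close>, and take a finitely supported \<open>x\<close> that almost norms \<open>T\<close>. Then \<open>x\<close> eventually almost norms \<open>R s\<close>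
  too, so \<open>T\<close> and \<open>R s\<close> are both small off the support of \<open>x\<close>, and on this finite support they are close by
  pointwise convergence. Hence \<open>R s\<close> tends to \<open>T\<close> in norm, which is the weak-star Kadec--Klee
  property (\<open>operators_from_lp_kadec_klee\<close>).

  Strong subdifferentiability follows for any space whose dual has that property
  (\<open>ssd_norm_if_weak_star_kadec_klee\<close>): functionals norming \<open>z + t h\<close> for small \<open>t\<close> cluster weak-star, hence in
  norm, at functionals norming \<open>z\<close>, which makes the one-sided derivative of the norm at \<open>z\<close> uniform in
  the direction \<open>h\<close>. The existence of norming functionals (Hahn--Banach) and the weak-star compactness of the dual
  ball (Banach--Alaoglu) are established on the way.
\<close>

section \<open>Norming functionals\<close>

definition sublinear :: "('a::real_vector \<Rightarrow> real) \<Rightarrow> bool" where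
  "sublinear q \<longleftrightarrow> (\<forall>x y. q (x + y) \<le> q x + q y) \<and> (\<forall>r>0. \<forall>x. q (r *\<^sub>R x) \<le> r * q x)"

lemma sublinear_add: "sublinear q \<Longrightarrow> q (x + y) \<le> q x + q y"
  and sublinear_scaleR: "sublinear q \<Longrightarrow> r > 0 \<Longrightarrow> q (r *\<^sub>R x) \<le> r * q x"
  by (simp_all add: sublinear_def)

lemma sublinear_zero: "sublinear q \<Longrightarrow> q 0 = 0"
  using sublinear_add[of q 0 0] sublinear_scaleR[of q "1/2" 0] by simp

lemma sublinear_minus: "sublinear q \<Longrightarrow> - q (- x) \<le> q x"
  using sublinear_add[of q x "- x"] sublinear_zero[of q] by simp

text \<open>
  The sublinear functional obtained from \<open>q\<close> by forcing the value \<open>- q v\<close> at \<open>- v\<close>. It is the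
  device behind the Hahn--Banach argument: it lies below \<open>q\<close>, so a minimal \<open>q\<close> coincides with all its
  slides and is therefore odd, that is, linear.
\<close>

definition slide :: "('a::real_vector \<Rightarrow> real) \<Rightarrow> 'a \<Rightarrow> 'a \<Rightarrow> real" where
  "slide q v x = (INF t\<in>{0..}. q (x + t *\<^sub>R v) - t * q v)"

lemma slide_bdd_below:
  assumes "sublinear q"
  shows "bdd_below ((\<lambda>t. q (x + t *\<^sub>R v) - t * q v) ` {0..})"
proof (rule bdd_belowI2)
  fix t :: real assume "t \<in> {0..}"
  then consider "t = 0" | "t > 0" by fastforce
  then show "- q (- x) \<le> q (x + t *\<^sub>R v) - t * q v"
  proof cases
    case 1
    then show ?thesis using sublinear_minus[OF assms] by simp
  next
    case 2
    have "v = inverse t *\<^sub>R ((x + t *\<^sub>R v) + - x)" using 2 by simp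
    then have "q v \<le> inverse t * q ((x + t *\<^sub>R v) + - x)"
      using sublinear_scaleR[OF assms, of "inverse t"] 2 by (metis positive_imp_inverse_positive)
    then have "t * q v \<le> q ((x + t *\<^sub>R v) + - x)" using 2 by (simp add: field_simps)
    also have "\<dots> \<le> q (x + t *\<^sub>R v) + q (- x)" by (rule sublinear_add[OF assms])
    finally show ?thesis by simp
  qed
qed

lemma slide_le:
  assumes "sublinear q" "t \<ge> 0"
  shows "slide q v x \<le> q (x + t *\<^sub>R v) - t * q v"
  unfolding slide_def using assms by (intro cINF_lower slide_bdd_below) auto

lemma sublinear_slide:
  assumes q: "sublinear q"
  shows "sublinear (slide q v)"
  unfolding sublinear_def
proof (intro conjI allI impI)
  fix x y
  have *: "slide q v (x + y) \<le> (q (x + s *\<^sub>R v) - s * q v) + (q (y + t *\<^sub>R v) - t * q v)"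
    if "s \<ge> 0" "t \<ge> 0" for s t
  proof -
    have "slide q v (x + y) \<le> q (x + y + (s + t) *\<^sub>R v) - (s + t) * q v"
      using q that by (intro slide_le) auto
    also have "x + y + (s + t) *\<^sub>R v = (x + s *\<^sub>R v) + (y + t *\<^sub>R v)"
      by (simp add: algebra_simps)
    finally show ?thesis
      using sublinear_add[OF q, of "x + s *\<^sub>R v" "y + t *\<^sub>R v"] by (simp add: algebra_simps)
  qed
  have "slide q v (x + y) - slide q v x \<le> q (y + t *\<^sub>R v) - t * q v" if "t \<ge> 0" for t
  proof -
    have "slide q v (x + y) - (q (y + t *\<^sub>R v) - t * q v) \<le> slide q v x"
      unfolding slide_def[of q v x] using *[OF _ that] by (intro cINF_greatest) (auto simp: algebra_simps)
    then show ?thesis by simp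
  qed
  then have "slide q v (x + y) - slide q v x \<le> slide q v y"
    unfolding slide_def[of q v y] by (intro cINF_greatest) auto
  then show "slide q v (x + y) \<le> slide q v x + slide q v y" by simp
next
  fix r :: real and x assume "r > 0"
  have "inverse r * slide q v (r *\<^sub>R x) \<le> q (x + t *\<^sub>R v) - t * q v" if "t \<ge> 0" for t
  proof -
    have "slide q v (r *\<^sub>R x) \<le> q (r *\<^sub>R (x + t *\<^sub>R v)) - (r * t) * q v"
      using slide_le[OF q, of "r * t" v "r *\<^sub>R x"] \<open>r > 0\<close> that by (simp add: algebra_simps)
    also have "\<dots> \<le> r * (q (x + t *\<^sub>R v) - t * q v)"
      using sublinear_scaleR[OF q \<open>r > 0\<close>, of "x + t *\<^sub>R v"] by (simp add: algebra_simps)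
    finally show ?thesis using \<open>r > 0\<close> by (simp add: field_simps)
  qed
  then have "inverse r * slide q v (r *\<^sub>R x) \<le> slide q v x"
    unfolding slide_def[of q v x] by (intro cINF_greatest) auto
  then show "slide q v (r *\<^sub>R x) \<le> r * slide q v x" using \<open>r > 0\<close> by (simp add: field_simps)
qed

text \<open>
  Subadditivity survives the infimum because two members of a chain that nearly attain the infima
  at \<open>x\<close> and at \<open>y\<close> can be replaced by the smaller of the two.
\<close>

lemma sublinear_INF_chain:
  assumes ne: "C \<noteq> {}" and sub: "\<And>q. q \<in> C \<Longrightarrow> sublinear q"
    and bdd: "\<And>x. bdd_below ((\<lambda>q. q x) ` C)"
    and chain: "\<And>q r. q \<in> C \<Longrightarrow> r \<in> C \<Longrightarrow> q \<le> r \<or> r \<le> q"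
  shows "sublinear (\<lambda>x. INF q\<in>C. q x)"
  unfolding sublinear_def
proof (intro conjI allI impI)
  fix x y
  have *: "(INF q\<in>C. q (x + y)) \<le> q x + r y" if qr: "q \<in> C" "r \<in> C" for q r
  proof -
    obtain s where s: "s \<in> C" "s \<le> q" "s \<le> r" using chain[OF qr] qr by auto
    have "(INF q\<in>C. q (x + y)) \<le> s (x + y)" using s bdd by (intro cINF_lower)
    also have "\<dots> \<le> s x + s y" using sub[OF s(1)] by (rule sublinear_add)
    also have "\<dots> \<le> q x + r y" using s by (intro add_mono) (auto simp: le_fun_def)
    finally show ?thesis .
  qed
  have "(INF q\<in>C. q (x + y)) - (INF q\<in>C. q x) \<le> r y" if "r \<in> C" for r
  proof -
    have "(INF q\<in>C. q (x + y)) - r y \<le> (INF q\<in>C. q x)"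
      using *[OF _ that] ne by (intro cINF_greatest) (auto simp: algebra_simps)
    then show ?thesis by simp
  qed
  then have "(INF q\<in>C. q (x + y)) - (INF q\<in>C. q x) \<le> (INF q\<in>C. q y)"
    using ne by (intro cINF_greatest) auto
  then show "(INF q\<in>C. q (x + y)) \<le> (INF q\<in>C. q x) + (INF q\<in>C. q y)" by simp
next
  fix r :: real and x assume "r > 0"
  have "inverse r * (INF q\<in>C. q (r *\<^sub>R x)) \<le> q x" if "q \<in> C" for q
  proof -
    have "(INF q\<in>C. q (r *\<^sub>R x)) \<le> q (r *\<^sub>R x)" using that bdd by (intro cINF_lower)
    also have "\<dots> \<le> r * q x" using sub[OF that] \<open>r > 0\<close> by (rule sublinear_scaleR)
    finally show ?thesis using \<open>r > 0\<close> by (simp add: field_simps)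
  qed
  then have "inverse r * (INF q\<in>C. q (r *\<^sub>R x)) \<le> (INF q\<in>C. q x)"
    using ne by (intro cINF_greatest) auto
  then show "(INF q\<in>C. q (r *\<^sub>R x)) \<le> r * (INF q\<in>C. q x)" using \<open>r > 0\<close> by (simp add: field_simps)
qed

text \<open>
  The Hahn--Banach theorem in its sublinear form. Zorn's lemma gives a minimal sublinear functional below
  \<open>q\<close>; minimality against its own slides makes it odd, and an odd sublinear functional is linear.
\<close>

lemma linear_below_sublinear:
  assumes q: "sublinear q"
  obtains f :: "'a::real_vector \<Rightarrow> real" where "linear f" "f \<le> q"
proof -
  define A where "A = {a. sublinear a \<and> a \<le> q}"
  have "\<exists>m\<in>A. \<forall>a\<in>A. m \<ge> a \<longrightarrow> a = m"
  proof (rule predicate_Zorn)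
    show "partial_order_on A (relation_of (\<lambda>a b. b \<le> a) A)"
      by (rule partial_order_on_relation_ofI) auto
  next
    fix C assume C: "C \<in> Chains (relation_of (\<lambda>a b. b \<le> a) A)"
    then have CA: "C \<subseteq> A" by (rule Chains_relation_of)
    show "\<exists>u\<in>A. \<forall>a\<in>C. u \<le> a"
    proof (cases "C = {}")
      case True
      then show ?thesis using q by (auto simp: A_def)
    next
      case False
      have bdd: "bdd_below ((\<lambda>a. a x) ` C)" for x
      proof (rule bdd_belowI2)
        fix a assume "a \<in> C"
        then have a: "sublinear a" "a \<le> q" using CA by (auto simp: A_def)
        show "- q (- x) \<le> a x"
          using sublinear_minus[OF a(1), of x] le_funD[OF a(2), of "- x"] by simp
      qed
      have chain: "a \<le> b \<or> b \<le> a" if "a \<in> C" "b \<in> C" for a b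
        using C that unfolding Chains_def relation_of_def by auto
      have "sublinear (\<lambda>x. INF a\<in>C. a x)"
        using False CA bdd chain by (intro sublinear_INF_chain) (auto simp: A_def)
      moreover have le: "(\<lambda>x. INF a\<in>C. a x) \<le> a" if "a \<in> C" for a
        using bdd that by (auto intro!: le_funI cINF_lower)
      moreover have "(\<lambda>x. INF a\<in>C. a x) \<le> q"
      proof -
        obtain a where a: "a \<in> C" using False by auto
        then have "a \<le> q" using CA by (auto simp: A_def)
        with le[OF a] show ?thesis by (rule order_trans)
      qed
      ultimately show ?thesis unfolding A_def by blast
    qed
  qed
  then obtain m where m: "sublinear m" "m \<le> q" and "\<forall>a\<in>A. a \<le> m \<longrightarrow> a = m"
    unfolding A_def by blast
  then have min: "a = m" if "sublinear a" "a \<le> m" for a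
    using that order_trans[OF that(2) m(2)] unfolding A_def by blast
  have odd: "m (- v) = - m v" for v
  proof -
    have "slide m v \<le> m"
      using slide_le[OF m(1), of 0 v] by (intro le_funI) simp
    then have "slide m v = m" using sublinear_slide[OF m(1)] by (intro min)
    then have "m (- v) \<le> - m v"
      using slide_le[OF m(1), of 1 v "- v"] sublinear_zero[OF m(1)] by simp
    then show ?thesis using sublinear_minus[OF m(1), of v] by simp
  qed
  have pos: "m (r *\<^sub>R x) = r * m x" if "r > 0" for r x
    using sublinear_scaleR[OF m(1) that, of x] sublinear_scaleR[OF m(1) that, of "- x"] odd by simp
  have "linear m"
  proof (rule linearI)
    fix x y
    show "m (x + y) = m x + m y"
      using sublinear_add[OF m(1), of x y] sublinear_add[OF m(1), of "- x" "- y"] odd[of "x + y"] odd[of x] odd[of y]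
      by simp
  next
    fix r :: real and x
    consider "r > 0" | "r = 0" | "- r > 0" by linarith
    then show "m (r *\<^sub>R x) = r *\<^sub>R m x"
      using pos[of r x] pos[of "- r" x] odd[of "r *\<^sub>R x"] sublinear_zero[OF m(1)] by cases auto
  qed
  then show thesis using m(2) by (rule that)
qed

lemma sublinear_norm: "sublinear (norm :: 'a::real_normed_vector \<Rightarrow> real)"
  by (simp add: sublinear_def norm_triangle_ineq)

text \<open>
  Sliding the norm along \<open>z\<close> forces the value at \<open>- z\<close> down to \<open>- norm z\<close>, so every linear functional
  below the slide attains its norm at \<open>z\<close>.
\<close>

lemma norming_functional:
  fixes z :: "'a::real_normed_vector"
  assumes "z \<noteq> 0"
  obtains f :: "'a \<Rightarrow>\<^sub>L real" where "norm f = 1" "blinfun_apply f z = norm z"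
proof -
  obtain g where g: "linear g" "g \<le> slide norm z"
    using linear_below_sublinear[OF sublinear_slide[OF sublinear_norm]] by blast
  have le: "g x \<le> norm x" for x
    using le_funD[OF g(2), of x] slide_le[OF sublinear_norm, of 0 z x] by simp
  have abs_le: "\<bar>g x\<bar> \<le> norm x" for x
    using le[of x] le[of "- x"] linear_neg[OF g(1), of x] by simp
  have "g (- z) \<le> - norm z"
    using le_funD[OF g(2), of "- z"] slide_le[OF sublinear_norm, of 1 z "- z"] by simp
  then have gz: "g z = norm z"
    using le[of z] linear_neg[OF g(1), of z] by simp
  have bl: "bounded_linear g"
    using g(1) abs_le by (intro bounded_linear_intro[where K = 1]) (auto simp: linear_add linear_scale)
  have "norm (Blinfun g) \<le> 1"
    using abs_le by (intro norm_blinfun_bound) (auto simp: bounded_linear_Blinfun_apply[OF bl])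
  moreover have "norm z \<le> norm (Blinfun g) * norm z"
    using norm_blinfun[of "Blinfun g" z] gz by (simp add: bounded_linear_Blinfun_apply[OF bl])
  ultimately have "norm (Blinfun g) = 1" using assms by (simp add: mult_le_cancel_right1)
  then show thesis using gz that by (simp add: bounded_linear_Blinfun_apply[OF bl])
qed

section \<open>Weak-star compactness of the dual ball\<close>

lemma compact_bounded_functions: "compact {c :: 'a \<Rightarrow> real. \<forall>b. \<bar>c b\<bar> \<le> r b}"
proof -
  have "compactin (product_topology (\<lambda>b. euclidean) UNIV) (\<Pi>\<^sub>E b\<in>UNIV. cball 0 (r b) :: real set)"
    by (auto simp: compactin_PiE)
  also have "(\<Pi>\<^sub>E b\<in>UNIV. cball 0 (r b)) = {c :: 'a \<Rightarrow> real. \<forall>b. \<bar>c b\<bar> \<le> r b}"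
    by (auto simp: PiE_iff)
  finally show ?thesis
    by (simp add: euclidean_product_topology)
qed

lemma limitin_weak_star_iff:
  "limitin weak_star_topology (\<lambda>g. g) f F \<longleftrightarrow> (\<forall>x. ((\<lambda>g. blinfun_apply g x) \<longlongrightarrow> blinfun_apply f x) F)"
proof
  assume L: "limitin weak_star_topology (\<lambda>g. g) f F"
  show "\<forall>x. ((\<lambda>g. blinfun_apply g x) \<longlongrightarrow> blinfun_apply f x) F"
    using continuous_map_limit[OF strong_operator_topology_continuous_evaluation L]
    by (simp add: comp_def)
next
  assume "\<forall>x. ((\<lambda>g. blinfun_apply g x) \<longlongrightarrow> blinfun_apply f x) F"
  then have "limitin (product_topology (\<lambda>_. euclidean) UNIV) blinfun_apply (blinfun_apply f) F"
    by (simp add: limitin_componentwise)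
  then have "(blinfun_apply \<longlongrightarrow> blinfun_apply f) F"
    by (simp add: euclidean_product_topology)
  then show "limitin weak_star_topology (\<lambda>g. g) f F"
    unfolding limitin_def strong_operator_topology_def
    by (auto simp: openin_pullback_topology topspace_pullback_topology dest: topological_tendstoD)
qed

text \<open>
  The Banach--Alaoglu theorem, in the form that any filter living on the dual ball has a finer proper
  filter that converges weak-star. The functionals of norm at most 1 sit inside the Tychonoff-compact set
  of functions dominated by the norm, and a pointwise limit of linear functionals is linear.
\<close>

lemma weak_star_cluster_point:
  fixes F :: "('a::real_normed_vector \<Rightarrow>\<^sub>L real) filter"
  assumes "F \<noteq> bot" and ball: "eventually (\<lambda>g. norm g \<le> 1) F"
  shows "\<exists>f G. G \<noteq> bot \<and> G \<le> F \<and> norm f \<le> 1 \<and> (\<forall>x. ((\<lambda>g. blinfun_apply g x) \<longlongrightarrow> blinfun_apply f x) G)"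
proof -
  let ?K = "{c :: 'a \<Rightarrow> real. \<forall>x. \<bar>c x\<bar> \<le> norm x}"
  have "eventually (\<lambda>c. c \<in> ?K) (filtermap blinfun_apply F)"
    unfolding eventually_filtermap using ball
  proof eventually_elim
    case (elim g)
    have "\<bar>blinfun_apply g x\<bar> \<le> norm x" for x
      using norm_blinfun[of g x] mult_right_mono[OF elim, of "norm x"] by simp
    then show ?case by simp
  qed
  moreover have "filtermap blinfun_apply F \<noteq> bot" using assms(1) by (simp add: filtermap_bot_iff)
  ultimately obtain \<phi> where \<phi>: "\<phi> \<in> ?K" and cluster: "inf (nhds \<phi>) (filtermap blinfun_apply F) \<noteq> bot"
    using compact_bounded_functions[of norm] unfolding compact_filter by blast
  define G where "G = inf (filtercomap blinfun_apply (nhds \<phi>)) F"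
  have "G \<noteq> bot"
  proof
    assume "G = bot"
    then have "eventually (\<lambda>_. False) G" by simp
    then obtain P Q where P: "eventually P (filtercomap blinfun_apply (nhds \<phi>))"
      and Q: "eventually Q F" and PQ: "\<And>g. P g \<Longrightarrow> Q g \<Longrightarrow> False"
      unfolding G_def eventually_inf by auto
    obtain R where R: "eventually R (nhds \<phi>)" "\<And>g. R (blinfun_apply g) \<Longrightarrow> P g"
      using P unfolding eventually_filtercomap by auto
    have "eventually (\<lambda>c. \<not> R c) (filtermap blinfun_apply F)"
      unfolding eventually_filtermap using Q by eventually_elim (use R PQ in auto)
    then have "eventually (\<lambda>_. False) (inf (nhds \<phi>) (filtermap blinfun_apply F))"
      unfolding eventually_inf using R(1) by blast
    then show False using cluster by (simp add: trivial_limit_def)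
  qed
  have lim: "((\<lambda>g. blinfun_apply g x) \<longlongrightarrow> \<phi> x) G" for x
  proof -
    have "(blinfun_apply \<longlongrightarrow> \<phi>) G"
      unfolding G_def by (rule filterlim_mono[OF filterlim_filtercomap]) auto
    then show ?thesis
      by (rule continuous_on_tendsto_compose[OF continuous_on_product_coordinates]) auto
  qed
  have "linear \<phi>"
  proof (rule linearI)
    fix x y
    have "((\<lambda>g. blinfun_apply g (x + y)) \<longlongrightarrow> \<phi> x + \<phi> y) G"
      unfolding blinfun.add_right by (intro tendsto_add lim)
    then show "\<phi> (x + y) = \<phi> x + \<phi> y" using lim tendsto_unique[OF \<open>G \<noteq> bot\<close>] by blast
  next
    fix r x
    have "((\<lambda>g. blinfun_apply g (r *\<^sub>R x)) \<longlongrightarrow> r *\<^sub>R \<phi> x) G"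
      unfolding blinfun.scaleR_right by (intro tendsto_scaleR lim tendsto_const)
    then show "\<phi> (r *\<^sub>R x) = r *\<^sub>R \<phi> x" using lim tendsto_unique[OF \<open>G \<noteq> bot\<close>] by blast
  qed
  then have bl: "bounded_linear \<phi>"
    using \<phi> by (intro bounded_linear_intro[where K = 1]) (auto simp: linear_add linear_scale)
  show ?thesis
  proof (intro exI conjI allI)
    show "G \<noteq> bot" "G \<le> F" using \<open>G \<noteq> bot\<close> by (simp_all add: G_def)
    show "norm (Blinfun \<phi>) \<le> 1"
      using \<phi> by (intro norm_blinfun_bound) (auto simp: bounded_linear_Blinfun_apply[OF bl])
    show "((\<lambda>g. blinfun_apply g x) \<longlongrightarrow> blinfun_apply (Blinfun \<phi>) x) G" for x
      using lim by (simp add: bounded_linear_Blinfun_apply[OF bl])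
  qed
qed

section \<open>From the Kadec--Klee property of the dual to strong subdifferentiability\<close>

text \<open>
  The directional derivative of the norm at \<open>z\<close> is an infimum of difference quotients, and it dominates every
  functional of norm 1 that takes the value 1 at \<open>z\<close>. If the convergence were not uniform, there would be
  steps \<open>t n\<close> tending to 0 and unit directions \<open>h n\<close> whose quotients stay \<open>e\<close> above the derivative.
  Functionals \<open>f n\<close> norming \<open>z + t n *\<^sub>R h n\<close> bound these quotients by their values at \<open>h n\<close>, and they
  tend to 1 at \<open>z\<close>. Hence a weak-star cluster point \<open>g\<close> of them is again a unit functional with \<open>g z = 1\<close>, and the
  Kadec--Klee property makes some \<open>f n\<close> uniformly close to \<open>g\<close>; so the quotient at \<open>h n\<close>
  cannot exceed the derivative by \<open>e\<close>.
\<close>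

theorem ssd_norm_if_weak_star_kadec_klee:
  assumes KK: "weak_star_kadec_klee TYPE('a::real_normed_vector)"
  shows "ssd_norm TYPE('a)"
  unfolding ssd_norm_def
proof
  fix z :: 'a assume "z \<in> sphere 0 1"
  then have z: "norm z = 1" by simp
  define Q where "Q t h = (norm (z + t *\<^sub>R h) - 1) / t" for t and h :: 'a
  define d where "d h = (INF t\<in>{0<..}. Q t h)" for h
  have Q_ge: "- norm h \<le> Q t h" if "t > 0" for t h
    using norm_triangle_ineq4[of "z + t *\<^sub>R h" "t *\<^sub>R h"] z that by (simp add: Q_def field_simps)
  have d_le: "d h \<le> Q t h" if "t > 0" for t h
    unfolding d_def using that Q_ge by (intro cINF_lower bdd_belowI2[of _ "- norm h"]) auto
  have small: "\<exists>\<delta>>0. \<forall>t h. 0 < t \<and> t < \<delta> \<and> norm h = 1 \<longrightarrow> Q t h < d h + e" if "e > 0" for e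
  proof (rule ccontr)
    assume "\<not> ?thesis"
    then have "\<forall>n. \<exists>t h. 0 < t \<and> t < inverse (real (Suc n)) \<and> norm h = 1 \<and> d h + e \<le> Q t h"
      by (metis inverse_positive_iff_positive not_le of_nat_0_less_iff zero_less_Suc)
    then obtain t h where t: "\<And>n. 0 < t n" "\<And>n. t n < inverse (real (Suc n))"
      and h: "\<And>n. norm (h n) = 1" and far: "\<And>n. d (h n) + e \<le> Q (t n) (h n)"
      by metis
    have ge: "1 - t n \<le> norm (z + t n *\<^sub>R h n)" for n
      using Q_ge[OF t(1)[of n], of "h n"] h[of n] t(1)[of n] by (simp add: Q_def field_simps)
    have "t n < 1" for n
      using less_le_trans[OF t(2)[of n], of 1] by (simp add: inverse_le_1_iff)
    then have "z + t n *\<^sub>R h n \<noteq> 0" for n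
      using ge[of n] by (metis diff_gt_0_iff_gt norm_zero not_le)
    then have "\<forall>n. \<exists>f. norm f = 1 \<and> blinfun_apply f (z + t n *\<^sub>R h n) = norm (z + t n *\<^sub>R h n)"
      by (metis norming_functional)
    then obtain f where f: "\<And>n. norm (f n) = 1"
      and norming: "\<And>n. blinfun_apply (f n) (z + t n *\<^sub>R h n) = norm (z + t n *\<^sub>R h n)"
      by metis
    have f_le: "blinfun_apply (f n) x \<le> norm x" for n x
      using norm_blinfun[of "f n" x] f[of n] by simp
    define F where "F = filtermap f sequentially"
    have "F \<noteq> bot" by (simp add: F_def filtermap_bot_iff)
    moreover have "\<forall>\<^sub>F k in F. norm k \<le> 1" by (simp add: F_def eventually_filtermap f)
    ultimately obtain g G where G: "G \<noteq> bot" "G \<le> F" and g: "norm g \<le> 1"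
      and lim: "\<And>x. ((\<lambda>k. blinfun_apply k x) \<longlongrightarrow> blinfun_apply g x) G"
      using weak_star_cluster_point[of F] by metis
    have "((\<lambda>n. blinfun_apply (f n) z) \<longlongrightarrow> 1) sequentially"
    proof (rule tendsto_sandwich)
      show "\<forall>\<^sub>F n in sequentially. 1 - 2 * inverse (real (Suc n)) \<le> blinfun_apply (f n) z"
      proof (intro always_eventually allI)
        fix n
        have "t n * blinfun_apply (f n) (h n) \<le> t n * 1"
          using f_le[of n "h n"] h[of n] t(1)[of n] by (intro mult_left_mono) auto
        then show "1 - 2 * inverse (real (Suc n)) \<le> blinfun_apply (f n) z"
          using norming[of n] ge[of n] t(2)[of n] by (simp add: blinfun.add_right blinfun.scaleR_right)
      qed
      show "\<forall>\<^sub>F n in sequentially. blinfun_apply (f n) z \<le> 1"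
        using f_le[of _ z] z by simp
      show "(\<lambda>n. 1 - 2 * inverse (real (Suc n))) \<longlonglongrightarrow> 1"
        using tendsto_diff[OF tendsto_const tendsto_mult_left[OF LIMSEQ_inverse_real_of_nat], of 1 2] by simp
    qed simp
    then have "((\<lambda>g. blinfun_apply g z) \<longlongrightarrow> 1) F"
      unfolding F_def by (simp add: filterlim_filtermap)
    then have gz: "blinfun_apply g z = 1"
      using lim[of z] G tendsto_unique tendsto_mono by blast
    then have g1: "norm g = 1" using norm_blinfun[of g z] z g by simp
    have evF: "eventually (\<lambda>k. k \<in> range f) F"
      by (simp add: F_def eventually_filtermap)
    then have ev: "eventually (\<lambda>k. k \<in> range f) G" using G(2) by (simp add: filter_leD)
    have "((\<lambda>k. norm (k - g)) \<longlongrightarrow> 0) G"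
    proof -
      have "eventually (\<lambda>k. k \<in> sphere 0 1) G"
        using ev by eventually_elim (use f in auto)
      then show ?thesis
        using KK g1 lim unfolding weak_star_kadec_klee_def limitin_weak_star_iff by simp
    qed
    then have "eventually (\<lambda>k. norm (k - g) < e) G" using that by (rule order_tendstoD(2))
    with ev have "eventually (\<lambda>k. k \<in> range f \<and> norm (k - g) < e) G" by (rule eventually_conj)
    then have "\<exists>k. k \<in> range f \<and> norm (k - g) < e" by (rule eventually_happens'[OF G(1)])
    then obtain n where n: "norm (f n - g) < e" by auto
    have "blinfun_apply g (h n) \<le> d (h n)"
      unfolding d_def
    proof (rule cINF_greatest)
      fix s :: real assume "s \<in> {0<..}"
      moreover have "blinfun_apply g (z + s *\<^sub>R h n) \<le> norm (z + s *\<^sub>R h n)"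
        using norm_blinfun[of g "z + s *\<^sub>R h n"] g1 by simp
      ultimately show "blinfun_apply g (h n) \<le> Q s (h n)"
        using gz by (simp add: Q_def blinfun.add_right blinfun.scaleR_right field_simps)
    qed simp
    moreover have "Q (t n) (h n) \<le> blinfun_apply (f n) (h n)"
      using norming[of n] f_le[of n z] z t(1)[of n]
      by (simp add: Q_def blinfun.add_right blinfun.scaleR_right field_simps)
    moreover have "blinfun_apply (f n) (h n) - blinfun_apply g (h n) < e"
      using norm_blinfun[of "f n - g" "h n"] h[of n] n by (simp add: blinfun.diff_left)
    ultimately show False using far[of n] by linarith
  qed
  have "uniform_limit (sphere 0 1) Q d (at_right 0)"
  proof (rule uniform_limitI)
    fix e :: real assume "e > 0"
    then obtain \<delta> where "\<delta> > 0" and \<delta>: "\<And>t h. 0 < t \<Longrightarrow> t < \<delta> \<Longrightarrow> norm h = 1 \<Longrightarrow> Q t h < d h + e"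
      using small by meson
    have "\<forall>\<^sub>F t in at_right 0. t \<in> {0<..<\<delta>}"
      by (rule eventually_at_rightI[OF _ \<open>\<delta> > 0\<close>])
    then show "\<forall>\<^sub>F t in at_right 0. \<forall>h\<in>sphere 0 1. dist (Q t h) (d h) < e"
    proof eventually_elim
      case (elim t)
      then show ?case using \<delta>[of t] d_le[of t] by (auto simp: dist_real_def abs_less_iff algebra_simps)
    qed
  qed
  then show "ssd_at z" unfolding ssd_at_def Q_def by blast
qed

section \<open>Functionals on finite-dimensional spaces\<close>

text \<open>
  All norms on a finite-dimensional space are equivalent: the norm is continuous and, by independence,
  positive on the compact sphere of coefficient vectors with \<open>\<ell>\<^sub>1\<close>-norm 1, hence bounded below there.
\<close>

lemma independent_coefficients_bound:
  fixes B :: "'a::real_normed_vector set"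
  assumes fin: "finite B" and ind: "independent B"
  shows "\<exists>C>0. \<forall>c. (\<Sum>b\<in>B. \<bar>c b\<bar>) \<le> C * norm (\<Sum>b\<in>B. c b *\<^sub>R b)"
proof (cases "B = {}")
  case True
  show ?thesis unfolding True by (intro exI[of _ 1]) simp
next
  case False
  define K where "K = {c :: 'a \<Rightarrow> real. \<forall>b. \<bar>c b\<bar> \<le> 1} \<inter> {c. (\<Sum>b\<in>B. \<bar>c b\<bar>) = 1}"
  define N where "N c = norm (\<Sum>b\<in>B. c b *\<^sub>R b)" for c :: "'a \<Rightarrow> real"
  have "compact K"
    unfolding K_def
    by (intro compact_Int_closed compact_bounded_functions closed_Collect_eq continuous_intros continuous_on_product_coordinates)
  moreover have "continuous_on K N"
    unfolding N_def
    by (intro continuous_intros continuous_on_subset[OF continuous_on_product_coordinates]) auto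
  moreover have "K \<noteq> {}"
  proof -
    obtain a where "a \<in> B" using False by auto
    then have "(\<lambda>b. if b = a then 1 else 0) \<in> K"
      using fin by (simp add: K_def if_distrib sum.delta cong: if_cong)
    then show ?thesis by blast
  qed
  ultimately obtain c0 where c0: "c0 \<in> K" and min: "\<And>c. c \<in> K \<Longrightarrow> N c0 \<le> N c"
    using continuous_attains_inf by metis
  have pos: "N c0 > 0"
  proof (rule ccontr)
    assume "\<not> ?thesis"
    then have "(\<Sum>b\<in>B. c0 b *\<^sub>R b) = 0" by (simp add: N_def)
    then have "c0 b = 0" if "b \<in> B" for b
      using independentD[OF ind fin subset_refl _ that] by blast
    then show False using c0 by (simp add: K_def)
  qed
  show ?thesis
  proof (intro exI conjI allI)
    show "1 / N c0 > 0" using pos by simp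
    fix c :: "'a \<Rightarrow> real"
    define S where "S = (\<Sum>b\<in>B. \<bar>c b\<bar>)"
    have S: "S \<ge> 0" unfolding S_def by (rule sum_nonneg) simp
    show "(\<Sum>b\<in>B. \<bar>c b\<bar>) \<le> 1 / N c0 * norm (\<Sum>b\<in>B. c b *\<^sub>R b)"
    proof (cases "S = 0")
      case True
      then show ?thesis using pos by (simp add: S_def)
    next
      case False
      then have "S > 0" using S by simp
      \<comment> \<open>normalise to the sphere, and cut off outside \<open>B\<close>, where \<open>c\<close> is unconstrained\<close>
      define c' where "c' b = (if b \<in> B then c b / S else 0)" for b
      have "\<bar>c b\<bar> \<le> S" if "b \<in> B" for b
        unfolding S_def using fin that by (intro member_le_sum) auto
      moreover have "(\<Sum>b\<in>B. \<bar>c' b\<bar>) = 1"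
        using \<open>S > 0\<close> by (simp add: c'_def abs_divide S_def[symmetric] flip: sum_divide_distrib)
      ultimately have "c' \<in> K"
        using \<open>S > 0\<close> by (auto simp: K_def c'_def field_simps)
      then have "N c0 \<le> N c'" by (rule min)
      also have "N c' = norm (inverse S *\<^sub>R (\<Sum>b\<in>B. c b *\<^sub>R b))"
        unfolding N_def scaleR_sum_right c'_def
        by (intro arg_cong[where f = norm] sum.cong) (auto simp: field_simps)
      also have "\<dots> = norm (\<Sum>b\<in>B. c b *\<^sub>R b) / S"
        using \<open>S > 0\<close> by (simp add: field_simps)
      finally show ?thesis using \<open>S > 0\<close> pos by (simp add: S_def[symmetric] field_simps)
    qed
  qed
qed

lemma finite_dimensional_functional_bound:
  assumes "finite_dimensional TYPE('y::real_normed_vector)"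
  shows "\<exists>(B :: 'y set) C. finite B \<and> C > 0 \<and> (\<forall>\<phi> :: 'y \<Rightarrow>\<^sub>L real. norm \<phi> \<le> C * (\<Sum>b\<in>B. \<bar>blinfun_apply \<phi> b\<bar>))"
proof -
  obtain B0 :: "'y set" where B0: "finite B0" "span B0 = UNIV"
    using assms unfolding finite_dimensional_def by blast
  obtain B where B: "B \<subseteq> B0" "independent B" "B0 \<subseteq> span B"
    using maximal_independent_subset by blast
  have fin: "finite B" using B(1) B0(1) by (rule finite_subset)
  have span: "span B = UNIV"
    using B0(2) span_minimal[OF B(3) subspace_span] by auto
  obtain C where C: "C > 0" "\<And>c. (\<Sum>b\<in>B. \<bar>c b\<bar>) \<le> C * norm (\<Sum>b\<in>B. c b *\<^sub>R b)"
    using independent_coefficients_bound[OF fin B(2)] by metis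
  have "norm \<phi> \<le> C * (\<Sum>b\<in>B. \<bar>blinfun_apply \<phi> b\<bar>)" for \<phi> :: "'y \<Rightarrow>\<^sub>L real"
  proof (rule norm_blinfun_bound)
    show "0 \<le> C * (\<Sum>b\<in>B. \<bar>blinfun_apply \<phi> b\<bar>)" using C(1) by (simp add: sum_nonneg)
    fix y
    obtain c where y: "y = (\<Sum>b\<in>B. c b *\<^sub>R b)"
      using span span_finite[OF fin] by blast
    have "norm (blinfun_apply \<phi> y) \<le> (\<Sum>b\<in>B. \<bar>c b\<bar> * \<bar>blinfun_apply \<phi> b\<bar>)"
      unfolding y blinfun.sum_right
      by (intro sum_norm_le) (simp add: blinfun.scaleR_right abs_mult)
    also have "\<dots> \<le> (\<Sum>b\<in>B. \<bar>c b\<bar> * (\<Sum>b\<in>B. \<bar>blinfun_apply \<phi> b\<bar>))"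
      using fin by (intro sum_mono mult_left_mono member_le_sum) auto
    also have "\<dots> = (\<Sum>b\<in>B. \<bar>c b\<bar>) * (\<Sum>b\<in>B. \<bar>blinfun_apply \<phi> b\<bar>)"
      by (simp add: sum_distrib_right)
    also have "\<dots> \<le> (C * norm y) * (\<Sum>b\<in>B. \<bar>blinfun_apply \<phi> b\<bar>)"
      using C(2)[of c] unfolding y by (intro mult_right_mono sum_nonneg) auto
    finally show "norm (blinfun_apply \<phi> y) \<le> C * (\<Sum>b\<in>B. \<bar>blinfun_apply \<phi> b\<bar>) * norm y"
      by (simp add: mult_ac)
  qed
  with fin C(1) show ?thesis by blast
qed

lemma tendsto_functional_if_pointwise:
  fixes \<phi> :: "'s \<Rightarrow> ('y::real_normed_vector \<Rightarrow>\<^sub>L real)"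
  assumes fd: "finite_dimensional TYPE('y)"
    and lim: "\<And>y. ((\<lambda>s. blinfun_apply (\<phi> s) y) \<longlongrightarrow> blinfun_apply \<psi> y) F"
  shows "(\<phi> \<longlongrightarrow> \<psi>) F"
proof -
  obtain B :: "'y set" and C where "C > 0"
    and bound: "\<And>\<phi> :: 'y \<Rightarrow>\<^sub>L real. norm \<phi> \<le> C * (\<Sum>b\<in>B. \<bar>blinfun_apply \<phi> b\<bar>)"
    using finite_dimensional_functional_bound[OF fd] by metis
  have "((\<lambda>s. C * (\<Sum>b\<in>B. \<bar>blinfun_apply (\<phi> s) b - blinfun_apply \<psi> b\<bar>)) \<longlongrightarrow> C * (\<Sum>b\<in>B. \<bar>blinfun_apply \<psi> b - blinfun_apply \<psi> b\<bar>)) F"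
    by (intro tendsto_intros lim)
  then have "((\<lambda>s. C * (\<Sum>b\<in>B. \<bar>blinfun_apply (\<phi> s) b - blinfun_apply \<psi> b\<bar>)) \<longlongrightarrow> 0) F" by simp
  then have "((\<lambda>s. \<phi> s - \<psi>) \<longlongrightarrow> 0) F"
  proof (rule Lim_null_comparison[rotated])
    show "\<forall>\<^sub>F s in F. norm (\<phi> s - \<psi>) \<le> C * (\<Sum>b\<in>B. \<bar>blinfun_apply (\<phi> s) b - blinfun_apply \<psi> b\<bar>)"
      using bound[of "\<phi> _ - \<psi>"] by (simp add: blinfun.diff_left)
  qed
  then show ?thesis by (simp add: LIM_zero_iff)
qed

section \<open>Supports and coordinate projections in \<open>\<ell>\<^sub>p\<close>\<close>

lemma is_lp_space_linear: "is_lp_space p I coord \<Longrightarrow> linear (\<lambda>x. coord x i)"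
  and is_lp_space_coord: "is_lp_space p I coord \<Longrightarrow> coord x \<in> lp_space p I"
  and is_lp_space_norm: "is_lp_space p I coord \<Longrightarrow> norm x = lp_norm p I (coord x)"
  by (auto simp: is_lp_space_def bij_betw_def)

lemma is_lp_space_eqI:
  assumes "is_lp_space p I coord" "\<And>i. coord x i = coord y i"
  shows "x = y"
  using assms unfolding is_lp_space_def bij_betw_def inj_def by blast

lemma norm_powr_eq_infsum:
  assumes lp: "is_lp_space p I coord" and "p > 0"
  shows "norm x powr p = (\<Sum>\<^sub>\<infinity>i\<in>I. \<bar>coord x i\<bar> powr p)"
proof -
  have "(\<Sum>\<^sub>\<infinity>i\<in>I. \<bar>coord x i\<bar> powr p) \<ge> 0" by (rule infsum_nonneg) simp
  then show ?thesis
    using \<open>p > 0\<close> by (simp add: is_lp_space_norm[OF lp] lp_norm_def powr_powr)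
qed

lemma coord_powr_summable:
  "is_lp_space p I coord \<Longrightarrow> (\<lambda>i. \<bar>coord x i\<bar> powr p) summable_on I"
  using is_lp_space_coord unfolding lp_space_def by blast

text \<open>
  The one metric property of \<open>\<ell>\<^sub>p\<close> behind the whole argument: disjoint perturbations are cheap.
\<close>

lemma norm_powr_add_disjoint:
  assumes lp: "is_lp_space p I coord" and "p > 0"
    and disj: "\<And>i. coord x i = 0 \<or> coord y i = 0"
  shows "norm (x + y) powr p = norm x powr p + norm y powr p"
proof -
  have "\<bar>coord (x + y) i\<bar> powr p = \<bar>coord x i\<bar> powr p + \<bar>coord y i\<bar> powr p" for i
    using disj[of i] linear_add[OF is_lp_space_linear[OF lp]] by fastforce
  then show ?thesis
    using infsum_add[OF coord_powr_summable[OF lp] coord_powr_summable[OF lp], of x y]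
    by (simp add: norm_powr_eq_infsum[OF lp \<open>p > 0\<close>])
qed

lemma ex_coord_restrict:
  assumes lp: "is_lp_space p I coord" and "p > 0"
  shows "\<exists>y. \<forall>i. coord y i = (if i \<in> A then coord x i else 0)"
proof -
  have "(\<lambda>i. if i \<in> A then coord x i else 0) \<in> lp_space p I"
  proof -
    have "(\<lambda>i. \<bar>if i \<in> A then coord x i else 0\<bar> powr p) summable_on I"
      by (rule summable_on_comparison_test[OF coord_powr_summable[OF lp, of x]]) (auto simp: \<open>p > 0\<close>)
    then show ?thesis using is_lp_space_coord[OF lp, of x] by (auto simp: lp_space_def)
  qed
  then obtain y where "coord y = (\<lambda>i. if i \<in> A then coord x i else 0)"
    using lp unfolding is_lp_space_def bij_betw_def by (metis imageE)
  then show ?thesis by metis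
qed

text \<open>
  The coordinate projection onto \<open>A\<close>. Since the space is only known through its coordinates, the
  projection is selected by them; they determine it uniquely because the coordinate map is injective.
\<close>

definition lp_restrict :: "('x \<Rightarrow> 'i \<Rightarrow> real) \<Rightarrow> 'i set \<Rightarrow> 'x \<Rightarrow> 'x" where
  "lp_restrict coord A x = (SOME y. \<forall>i. coord y i = (if i \<in> A then coord x i else 0))"

lemma coord_lp_restrict:
  assumes "is_lp_space p I coord" "p > 0"
  shows "coord (lp_restrict coord A x) i = (if i \<in> A then coord x i else 0)"
  using someI_ex[OF ex_coord_restrict[OF assms, of A x]] unfolding lp_restrict_def by blast

lemma lp_restrict_decompose:
  assumes lp: "is_lp_space p I coord" and p: "p > 0"
  shows "x = lp_restrict coord A x + lp_restrict coord (- A) x"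
  by (rule is_lp_space_eqI[OF lp])
     (simp add: linear_add[OF is_lp_space_linear[OF lp]] coord_lp_restrict[OF lp p])

lemma norm_powr_lp_restrict:
  assumes lp: "is_lp_space p I coord" and p: "p > 0"
  shows "norm x powr p = norm (lp_restrict coord A x) powr p + norm (lp_restrict coord (- A) x) powr p"
  using norm_powr_add_disjoint[OF lp p, of "lp_restrict coord A x" "lp_restrict coord (- A) x"]
  by (simp add: coord_lp_restrict[OF lp p] flip: lp_restrict_decompose[OF lp p])

lemma norm_lp_restrict_le:
  assumes lp: "is_lp_space p I coord" and p: "p > 0"
  shows "norm (lp_restrict coord A x) \<le> norm x"
proof (rule ccontr)
  assume "\<not> ?thesis"
  then have "norm x powr p < norm (lp_restrict coord A x) powr p"
    using p by (intro powr_less_mono2) auto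
  then show False
    using norm_powr_lp_restrict[OF lp p, of x A] powr_ge_zero[of "norm (lp_restrict coord (- A) x)" p] by linarith
qed

lemma lp_restrict_finite_approx:
  assumes lp: "is_lp_space p I coord" and p: "p > 0" and "e > 0"
  shows "\<exists>F. finite F \<and> F \<subseteq> I \<and> norm (x - lp_restrict coord F x) < e"
proof -
  have "((\<lambda>i. \<bar>coord x i\<bar> powr p) has_sum norm x powr p) I"
    using has_sum_infsum[OF coord_powr_summable[OF lp, of x]] by (simp add: norm_powr_eq_infsum[OF lp p])
  then have "((\<lambda>F. \<Sum>i\<in>F. \<bar>coord x i\<bar> powr p) \<longlongrightarrow> norm x powr p) (finite_subsets_at_top I)"
    unfolding has_sum_def .
  moreover have "norm x powr p - e powr p < norm x powr p" using \<open>e > 0\<close> by simp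
  ultimately have "\<forall>\<^sub>F F in finite_subsets_at_top I. norm x powr p - e powr p < (\<Sum>i\<in>F. \<bar>coord x i\<bar> powr p)"
    by (rule order_tendstoD(1))
  then obtain F where F: "finite F" "F \<subseteq> I" and large: "norm x powr p - e powr p < (\<Sum>i\<in>F. \<bar>coord x i\<bar> powr p)"
    unfolding eventually_finite_subsets_at_top by blast
  have "norm (lp_restrict coord F x) powr p = (\<Sum>\<^sub>\<infinity>i\<in>I. \<bar>if i \<in> F then coord x i else 0\<bar> powr p)"
    by (simp add: norm_powr_eq_infsum[OF lp p] coord_lp_restrict[OF lp p])
  also have "\<dots> = (\<Sum>\<^sub>\<infinity>i\<in>F. \<bar>coord x i\<bar> powr p)"
    using F p by (intro infsum_cong_neutral) auto
  also have "\<dots> = (\<Sum>i\<in>F. \<bar>coord x i\<bar> powr p)" using F(1) by simp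
  finally have "norm (lp_restrict coord (- F) x) powr p < e powr p"
    using large norm_powr_lp_restrict[OF lp p, of x F] by linarith
  then have "norm (lp_restrict coord (- F) x) < e"
    using p \<open>e > 0\<close> by (meson less_le_not_le not_le powr_mono2 less_imp_le)
  moreover have "x - lp_restrict coord F x = lp_restrict coord (- F) x"
    using lp_restrict_decompose[OF lp p, of x F] by (metis add_diff_cancel_left')
  ultimately show ?thesis using F by auto
qed

lemma ex_lp_unit_vector:
  assumes lp: "is_lp_space p I coord" and p: "p > 0" and "i \<in> I"
  shows "\<exists>u. \<forall>x. lp_restrict coord {i} x = coord x i *\<^sub>R u \<and> \<bar>coord x i\<bar> \<le> norm x"
proof -
  have "(\<lambda>j. if j = i then 1 else 0) \<in> lp_space p I"
  proof -
    have "(\<lambda>j. \<bar>if j = i then 1 else 0 :: real\<bar> powr p) summable_on I \<longleftrightarrow> (\<lambda>j. 1 :: real) summable_on {i}"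
      using assms by (intro summable_on_cong_neutral) auto
    then show ?thesis using \<open>i \<in> I\<close> by (auto simp: lp_space_def)
  qed
  then obtain u where u: "coord u = (\<lambda>j. if j = i then 1 else 0)"
    using lp unfolding is_lp_space_def bij_betw_def by (metis imageE)
  have eq: "lp_restrict coord {i} x = coord x i *\<^sub>R u" for x
    by (rule is_lp_space_eqI[OF lp])
       (simp add: coord_lp_restrict[OF lp p] linear_scale[OF is_lp_space_linear[OF lp]] u)
  have "norm u powr p = (\<Sum>\<^sub>\<infinity>j\<in>{i}. 1)"
    unfolding norm_powr_eq_infsum[OF lp p] u using assms by (intro infsum_cong_neutral) auto
  then have "norm u powr p = 1" by simp
  moreover have "norm u = (norm u powr p) powr (1 / p)" using p by (simp add: powr_powr)
  ultimately have "norm u = 1" by simp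
  then have "\<bar>coord x i\<bar> \<le> norm x" for x
    using norm_lp_restrict_le[OF lp p, of "{i}" x] by (simp add: eq)
  with eq show ?thesis by blast
qed

lemma lp_restrict_finite_sum:
  assumes lp: "is_lp_space p I coord" and p: "p > 0" and "finite F"
  shows "lp_restrict coord F x = (\<Sum>i\<in>F. lp_restrict coord {i} x)"
proof (rule is_lp_space_eqI[OF lp])
  fix j
  have "coord (\<Sum>i\<in>F. lp_restrict coord {i} x) j = (\<Sum>i\<in>F. if j = i then coord x j else 0)"
    by (simp add: linear_sum[OF is_lp_space_linear[OF lp]] coord_lp_restrict[OF lp p])
  then show "coord (lp_restrict coord F x) j = coord (\<Sum>i\<in>F. lp_restrict coord {i} x) j"
    using \<open>finite F\<close> by (simp add: coord_lp_restrict[OF lp p])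
qed

section \<open>Operators from \<open>\<ell>\<^sub>p\<close> into a space of smaller power type\<close>

lemma convexity_of_power_typeE:
  assumes "convexity_of_power_type TYPE('z::real_normed_vector) q"
  obtains C where "C > 0"
    "\<And>(u::'z) v \<epsilon>. norm u \<le> 1 \<Longrightarrow> norm v \<le> 1 \<Longrightarrow> 0 < \<epsilon> \<Longrightarrow> \<epsilon> \<le> 2 \<Longrightarrow> \<epsilon> \<le> norm (u - v) \<Longrightarrow>
       norm (u + v) / 2 \<le> 1 - C * \<epsilon> powr q"
proof -
  obtain C where C: "C > 0" "\<And>\<epsilon>. 0 < \<epsilon> \<Longrightarrow> \<epsilon> \<le> 2 \<Longrightarrow> ereal (C * \<epsilon> powr q) \<le> modulus_of_convexity TYPE('z) \<epsilon>"
    using assms unfolding convexity_of_power_type_def by blast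
  have "norm (u + v) / 2 \<le> 1 - C * \<epsilon> powr q"
    if "norm u \<le> 1" "norm v \<le> 1" "0 < \<epsilon>" "\<epsilon> \<le> 2" "\<epsilon> \<le> norm (u - v)" for u v :: 'z and \<epsilon>
  proof -
    have "modulus_of_convexity TYPE('z) \<epsilon> \<le> ereal (1 - norm (u + v) / 2)"
      unfolding modulus_of_convexity_def using that by (intro Inf_lower) auto
    then have "ereal (C * \<epsilon> powr q) \<le> ereal (1 - norm (u + v) / 2)"
      using C(2)[OF that(3,4)] by (rule order_trans[rotated])
    then show ?thesis by simp
  qed
  with C(1) show thesis by (rule that)
qed

lemma norm_add_disjoint_le:
  assumes lp: "is_lp_space p I coord" and p: "p \<ge> 1"
    and "norm x \<le> 1" "norm y \<le> 1" and disj: "\<And>i. coord x i = 0 \<or> coord y i = 0"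
  shows "norm (x + t *\<^sub>R y) \<le> 1 + \<bar>t\<bar> powr p"
proof -
  have p0: "p > 0" using p by simp
  have "norm (x + t *\<^sub>R y) powr p = norm x powr p + norm (t *\<^sub>R y) powr p"
    using disj by (intro norm_powr_add_disjoint[OF lp p0]) (auto simp: linear_scale[OF is_lp_space_linear[OF lp]])
  also have "\<dots> \<le> 1 + \<bar>t\<bar> powr p * 1"
    using assms powr_mono2[of p "norm x" 1] powr_mono2[of p "norm y" 1]
    unfolding norm_scaleR powr_mult by (intro add_mono mult_left_mono) auto
  also have "\<dots> \<le> (1 + \<bar>t\<bar> powr p) powr p"
    using powr_mono[of 1 p "1 + \<bar>t\<bar> powr p"] p by (simp add: powr_one)
  finally have le: "norm (x + t *\<^sub>R y) powr p \<le> (1 + \<bar>t\<bar> powr p) powr p" .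
  show ?thesis
  proof (rule ccontr)
    assume "\<not> ?thesis"
    then have "(1 + \<bar>t\<bar> powr p) powr p < norm (x + t *\<^sub>R y) powr p"
      using p0 by (intro powr_less_mono2) (auto intro: add_nonneg_nonneg)
    with le show False by simp
  qed
qed

text \<open>
  The bound depends only on how close \<open>norm (R x)\<close> is to 1, not on \<open>R\<close>. Perturbing \<open>x\<close> to \<open>x \<plusminus> t y\<close> increases the norm to at
  most \<open>1 + t\<^sup>p\<close>. If \<open>norm (R y) \<ge> e\<close>, the images of these two vectors are at least \<open>2 t e\<close> apart,
  so power type \<open>q\<close> puts their midpoint \<open>R x\<close> a distance of order \<open>C (t e)\<^sup>q\<close> below the
  bound \<open>1 + t\<^sup>p\<close>. As \<open>q < p\<close>, for small \<open>t\<close> this deficit outweighs the increase \<open>t\<^sup>p\<close>, and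
  \<open>norm (R x)\<close> stays away from 1.
\<close>

lemma small_off_support_of_norming_vector:
  fixes coord :: "'x::real_normed_vector \<Rightarrow> 'i \<Rightarrow> real"
  assumes lp: "is_lp_space p I coord" and p: "p \<ge> 1" and q: "0 < q" "q < p"
    and conv: "convexity_of_power_type TYPE('z::real_normed_vector) q" and "e > 0"
  shows "\<exists>\<eta>>0. \<forall>(R :: 'x \<Rightarrow>\<^sub>L 'z) x y. norm R \<le> 1 \<and> norm x \<le> 1 \<and> norm y \<le> 1 \<and>
           (\<forall>i. coord x i = 0 \<or> coord y i = 0) \<and> 1 - \<eta> < norm (blinfun_apply R x) \<longrightarrow>
           norm (blinfun_apply R y) < e"
proof -
  obtain C where C: "C > 0" and mid: "\<And>(u::'z) v \<epsilon>. norm u \<le> 1 \<Longrightarrow> norm v \<le> 1 \<Longrightarrow> 0 < \<epsilon> \<Longrightarrow> \<epsilon> \<le> 2 \<Longrightarrow>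
      \<epsilon> \<le> norm (u - v) \<Longrightarrow> norm (u + v) / 2 \<le> 1 - C * \<epsilon> powr q"
    using convexity_of_power_typeE[OF conv] by metis
  \<comment> \<open>the modulus of convexity is only controlled for distances up to 2, so \<open>e\<close> is truncated\<close>
  define d where "d = min e 1"
  have d: "0 < d" "d \<le> 1" "d \<le> e" using \<open>e > 0\<close> by (auto simp: d_def)
  \<comment> \<open>chosen so that \<open>t powr (p - q)\<close> is at most half of \<open>C * d powr q\<close>\<close>
  define t where "t = min 1 ((C * d powr q / 2) powr (1 / (p - q)))"
  have t: "0 < t" "t \<le> 1" using C d by (auto simp: t_def)
  have "t powr (p - q) \<le> ((C * d powr q / 2) powr (1 / (p - q))) powr (p - q)"
    using q t by (intro powr_mono2) (auto simp: t_def)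
  also have "\<dots> = C * d powr q / 2" using q C d by (simp add: powr_powr)
  also have "\<dots> < C * d powr q" using C d by simp
  finally have "t powr q * t powr (p - q) < t powr q * (C * d powr q)"
    using t by (intro mult_strict_left_mono) auto
  then have gain: "t powr p < C * (t * d) powr q"
    using t d by (simp add: powr_mult mult_ac flip: powr_add)
  define \<eta> where "\<eta> = C * (t * d) powr q - t powr p"
  define m where "m = 1 + t powr p"
  have m: "1 \<le> m" "m \<le> 2" using t q powr_le1[of p t] by (auto simp: m_def)
  show ?thesis
  proof (intro exI[of _ \<eta>] conjI allI impI)
    show "\<eta> > 0" using gain by (simp add: \<eta>_def)
  next
    fix R :: "'x \<Rightarrow>\<^sub>L 'z" and x y
    assume asm: "norm R \<le> 1 \<and> norm x \<le> 1 \<and> norm y \<le> 1 \<and>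
           (\<forall>i. coord x i = 0 \<or> coord y i = 0) \<and> 1 - \<eta> < norm (blinfun_apply R x)"
    show "norm (blinfun_apply R y) < e"
    proof (rule ccontr)
      assume "\<not> ?thesis"
      then have Ry: "d \<le> norm (blinfun_apply R y)" using d by simp
      define u where "u s = (1 / m) *\<^sub>R blinfun_apply R (x + s *\<^sub>R y)" for s
      have u: "norm (u s) \<le> 1" if "\<bar>s\<bar> = t" for s
      proof -
        have "norm (blinfun_apply R (x + s *\<^sub>R y)) \<le> norm R * norm (x + s *\<^sub>R y)" by (rule norm_blinfun)
        also have "\<dots> \<le> 1 * (1 + \<bar>s\<bar> powr p)"
          using asm by (intro mult_mono norm_add_disjoint_le[OF lp p]) auto
        finally have "norm (blinfun_apply R (x + s *\<^sub>R y)) \<le> m" using that by (simp add: m_def)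
        then show ?thesis using m by (simp add: u_def field_simps)
      qed
      have "u t - u (- t) = (2 * t / m) *\<^sub>R blinfun_apply R y"
        unfolding u_def by (simp add: blinfun.add_right blinfun.diff_right blinfun.scaleR_right algebra_simps flip: scaleR_add_left)
      then have "norm (u t - u (- t)) = 2 * t / m * norm (blinfun_apply R y)"
        using t m by simp
      also have "\<dots> \<ge> t * d"
        using t m d Ry by (intro mult_mono) (auto simp: field_simps)
      finally have apart: "t * d \<le> norm (u t - u (- t))" .
      have "t * d \<le> 1" using t d by (simp add: mult_le_one)
      then have "norm (u t + u (- t)) / 2 \<le> 1 - C * (t * d) powr q"
        using t d by (intro mid u apart) auto
      moreover have "u t + u (- t) = (2 / m) *\<^sub>R blinfun_apply R x"
        unfolding u_def by (simp add: blinfun.add_right blinfun.diff_right blinfun.scaleR_right algebra_simps flip: scaleR_add_left)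
      ultimately have "norm (blinfun_apply R x) \<le> m * (1 - C * (t * d) powr q)"
        using m by (simp add: field_simps)
      also have "\<dots> \<le> m - 1 * (C * (t * d) powr q)"
        using m C mult_right_mono[OF m(1), of "C * (t * d) powr q"] by (simp add: algebra_simps)
      also have "\<dots> = 1 - \<eta>" by (simp add: m_def \<eta>_def)
      finally show False using asm by simp
    qed
  qed
qed

lemma norm_blinfun_le_on_ball:
  fixes R :: "'a::real_normed_vector \<Rightarrow>\<^sub>L 'b::real_normed_vector"
  assumes "0 \<le> b" "\<And>x. norm x \<le> 1 \<Longrightarrow> norm (blinfun_apply R x) \<le> b"
  shows "norm R \<le> b"
proof (rule norm_blinfun_bound)
  fix x
  show "norm (blinfun_apply R x) \<le> b * norm x"
    using assms(2)[of "inverse (norm x) *\<^sub>R x"]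
    by (cases "x = 0") (auto simp: blinfun.scaleR_right field_simps)
qed fact

text \<open>
  Let \<open>x\<close> be a vector with finite support \<open>J\<close> at which \<open>T\<close> almost attains its norm. By pointwise
  convergence \<open>R s\<close> eventually almost attains norm 1 at the same \<open>x\<close>. The previous estimate therefore
  applies to \<open>T\<close> and to \<open>R s\<close>: both are uniformly small on the vectors supported off \<open>J\<close>. On the
  finitely many coordinates in \<open>J\<close> pointwise convergence is already uniform on the unit ball.
\<close>

theorem operators_from_lp_kadec_klee:
  fixes coord :: "'x::real_normed_vector \<Rightarrow> 'i \<Rightarrow> real" and R :: "'s \<Rightarrow> 'x \<Rightarrow>\<^sub>L 'z::real_normed_vector"
  assumes lp: "is_lp_space p I coord" and p: "p \<ge> 1" and q: "0 < q" "q < p"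
    and conv: "convexity_of_power_type TYPE('z) q"
    and R: "\<forall>\<^sub>F s in F. norm (R s) \<le> 1" and T: "norm T = 1"
    and lim: "\<And>x. ((\<lambda>s. blinfun_apply (R s) x) \<longlongrightarrow> blinfun_apply T x) F"
  shows "(R \<longlongrightarrow> T) F"
proof (rule tendstoI)
  fix e :: real assume "e > 0"
  have p0: "p > 0" using p by simp
  have "e / 4 > 0" using \<open>e > 0\<close> by simp
  from small_off_support_of_norming_vector[OF lp p q conv this]
  obtain \<eta> where \<eta>: "\<eta> > 0" and small: "\<And>(R :: 'x \<Rightarrow>\<^sub>L 'z) x y. norm R \<le> 1 \<Longrightarrow> norm x \<le> 1 \<Longrightarrow> norm y \<le> 1 \<Longrightarrow>
      (\<And>i. coord x i = 0 \<or> coord y i = 0) \<Longrightarrow> 1 - \<eta> < norm (blinfun_apply R x) \<Longrightarrow> norm (blinfun_apply R y) < e / 4"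
    by metis
  have "\<exists>x. norm x \<le> 1 \<and> 1 - \<eta> / 2 < norm (blinfun_apply T x)"
  proof (rule ccontr)
    assume "\<not> ?thesis"
    then have "norm T \<le> max 0 (1 - \<eta> / 2)" by (intro norm_blinfun_le_on_ball) (auto simp: not_less le_max_iff_disj)
    then show False using T \<eta> by simp
  qed
  then obtain x0 where x0: "norm x0 \<le> 1" "1 - \<eta> / 2 < norm (blinfun_apply T x0)" by blast
  obtain J where J: "finite J" "J \<subseteq> I" and near: "norm (x0 - lp_restrict coord J x0) < \<eta> / 2"
    using lp_restrict_finite_approx[OF lp p0, of "\<eta> / 2" x0] \<eta> by auto
  define x where "x = lp_restrict coord J x0"
  have x: "norm x \<le> 1" using norm_lp_restrict_le[OF lp p0, of J x0] x0(1) by (simp add: x_def)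
  have "norm (blinfun_apply T x0) \<le> norm (blinfun_apply T x) + norm (blinfun_apply T (x0 - x))"
    by (metis blinfun.diff_right norm_triangle_sub)
  moreover have "norm (blinfun_apply T (x0 - x)) < \<eta> / 2"
    using norm_blinfun[of T "x0 - x"] T near by (simp add: x_def)
  ultimately have Tx: "1 - \<eta> < norm (blinfun_apply T x)" using x0(2) by simp
  have ev1: "\<forall>\<^sub>F s in F. 1 - \<eta> < norm (blinfun_apply (R s) x)"
    using order_tendstoD(1)[OF tendsto_norm[OF lim] Tx] .
  have "\<forall>i\<in>J. \<exists>u. \<forall>x. lp_restrict coord {i} x = coord x i *\<^sub>R u \<and> \<bar>coord x i\<bar> \<le> norm x"
    using ex_lp_unit_vector[OF lp p0] J by blast
  then obtain u where u: "\<And>i x. i \<in> J \<Longrightarrow> lp_restrict coord {i} x = coord x i *\<^sub>R u i"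
    and coord_le: "\<And>i x. i \<in> J \<Longrightarrow> \<bar>coord x i\<bar> \<le> norm x" by metis
  have "((\<lambda>s. \<Sum>i\<in>J. norm (blinfun_apply (R s) (u i) - blinfun_apply T (u i))) \<longlongrightarrow>
      (\<Sum>i\<in>J. norm (blinfun_apply T (u i) - blinfun_apply T (u i)))) F"
    by (intro tendsto_intros lim)
  then have ev2: "\<forall>\<^sub>F s in F. (\<Sum>i\<in>J. norm (blinfun_apply (R s) (u i) - blinfun_apply T (u i))) < e / 4"
    using \<open>e > 0\<close> by (intro order_tendstoD(2)) auto
  show "\<forall>\<^sub>F s in F. dist (R s) T < e"
    using R ev1 ev2
  proof eventually_elim
    case (elim s)
    have "norm (R s - T) \<le> 3 * e / 4"
    proof (rule norm_blinfun_le_on_ball)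
      fix y :: 'x assume y: "norm y \<le> 1"
      define y1 y2 where "y1 = lp_restrict coord J y" and "y2 = lp_restrict coord (- J) y"
      have y2: "norm y2 \<le> 1" using norm_lp_restrict_le[OF lp p0, of "- J" y] y by (simp add: y2_def)
      have disj: "coord x i = 0 \<or> coord y2 i = 0" for i
        by (simp add: x_def y2_def coord_lp_restrict[OF lp p0])
      have "y1 = (\<Sum>i\<in>J. coord y i *\<^sub>R u i)"
        unfolding y1_def lp_restrict_finite_sum[OF lp p0 J(1)] by (intro sum.cong u) auto
      then have "norm (blinfun_apply (R s - T) y1) \<le> (\<Sum>i\<in>J. norm (coord y i *\<^sub>R blinfun_apply (R s - T) (u i)))"
        by (simp only: blinfun.sum_right blinfun.scaleR_right norm_sum)
      also have "\<dots> \<le> (\<Sum>i\<in>J. norm (blinfun_apply (R s) (u i) - blinfun_apply T (u i)))"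
      proof (rule sum_mono)
        fix i assume "i \<in> J"
        then have "\<bar>coord y i\<bar> \<le> 1" using coord_le[of i y] y by simp
        then show "norm (coord y i *\<^sub>R blinfun_apply (R s - T) (u i)) \<le> norm (blinfun_apply (R s) (u i) - blinfun_apply T (u i))"
          by (simp add: blinfun.diff_left mult_left_le_one_le)
      qed
      finally have 1: "norm (blinfun_apply (R s - T) y1) \<le> e / 4" using elim(3) by simp
      have 2: "norm (blinfun_apply (R s) y2) < e / 4" using small[OF elim(1) x y2 disj elim(2)] .
      have 3: "norm (blinfun_apply T y2) < e / 4" using small[OF _ x y2 disj Tx] T by simp
      have "blinfun_apply (R s - T) y = blinfun_apply (R s - T) y1 + (blinfun_apply (R s) y2 - blinfun_apply T y2)"
        using lp_restrict_decompose[OF lp p0, of y J] unfolding y1_def y2_def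
        by (metis blinfun.add_right blinfun.diff_left)
      then have "norm (blinfun_apply (R s - T) y) \<le> norm (blinfun_apply (R s - T) y1) + (norm (blinfun_apply (R s) y2) + norm (blinfun_apply T y2))"
        using norm_triangle_le[OF add_left_mono[OF norm_triangle_ineq4]] by simp
      then show "norm (blinfun_apply (R s - T) y) \<le> 3 * e / 4" using 1 2 3 by simp
    qed (use \<open>e > 0\<close> in simp)
    then show ?case using \<open>e > 0\<close> by (simp add: dist_norm)
  qed
qed

section \<open>The dual of the projective tensor product\<close>

lemma bounded_bilinear_elementary_tensor:
  "bounded_bilinear (\<lambda>(x::'x::real_normed_vector) (y::'y::real_normed_vector). of_alg_tensor (x \<otimes>\<^sub>a y))"
proof
  fix x x' :: 'x and y y' :: 'y and r :: real
  note lin = linear_add[OF linear_of_alg_tensor] linear_scale[OF linear_of_alg_tensor]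
  show "of_alg_tensor ((x + x') \<otimes>\<^sub>a y) = of_alg_tensor (x \<otimes>\<^sub>a y) + of_alg_tensor (x' \<otimes>\<^sub>a y)"
    by (simp add: bilinear_ladd[OF tensor_bilinear] lin)
  show "of_alg_tensor (x \<otimes>\<^sub>a (y + y')) = of_alg_tensor (x \<otimes>\<^sub>a y) + of_alg_tensor (x \<otimes>\<^sub>a y')"
    by (simp add: bilinear_radd[OF tensor_bilinear] lin)
  show "of_alg_tensor ((r *\<^sub>R x) \<otimes>\<^sub>a y) = r *\<^sub>R of_alg_tensor (x \<otimes>\<^sub>a y)"
    by (simp add: bilinear_lmul[OF tensor_bilinear] lin)
  show "of_alg_tensor (x \<otimes>\<^sub>a (r *\<^sub>R y)) = r *\<^sub>R of_alg_tensor (x \<otimes>\<^sub>a y)"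
    by (simp add: bilinear_rmul[OF tensor_bilinear] lin)
  have "norm (of_alg_tensor (x \<otimes>\<^sub>a y)) \<le> norm x * norm y * 1" for x :: 'x and y :: 'y
    using proj_norm_le[of "x \<otimes>\<^sub>a y" "[(x, y)]"] by (simp add: norm_of_alg_tensor)
  then show "\<exists>K. \<forall>(x::'x) (y::'y). norm (of_alg_tensor (x \<otimes>\<^sub>a y)) \<le> norm x * norm y * K" by blast
qed

text \<open>
  The canonical map from the dual of the projective tensor product to the operators from \<open>'x\<close> into the
  dual of \<open>'y\<close>.
\<close>

definition operator_of :: "(('x::real_normed_vector, 'y::real_normed_vector) proj_tensor \<Rightarrow>\<^sub>L real) \<Rightarrow> 'x \<Rightarrow>\<^sub>L ('y \<Rightarrow>\<^sub>L real)" where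
  "operator_of f = Blinfun (\<lambda>x. f o\<^sub>L bounded_bilinear.prod_right (\<lambda>x y. of_alg_tensor (x \<otimes>\<^sub>a y)) x)"

lemma operator_of_apply:
  fixes f :: "('x::real_normed_vector, 'y::real_normed_vector) proj_tensor \<Rightarrow>\<^sub>L real"
  shows "blinfun_apply (blinfun_apply (operator_of f) x) y = blinfun_apply f (of_alg_tensor (x \<otimes>\<^sub>a y))"
proof -
  note bb = bounded_bilinear_elementary_tensor
  have "bounded_linear (\<lambda>x. f o\<^sub>L bounded_bilinear.prod_right (\<lambda>(x::'x) (y::'y). of_alg_tensor (x \<otimes>\<^sub>a y)) x)"
    by (rule bounded_linear_compose[OF bounded_bilinear.bounded_linear_right[OF bounded_bilinear_blinfun_compose]
          bounded_bilinear.bounded_linear_prod_right[OF bb]])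
  then show ?thesis
    by (simp add: operator_of_def bounded_linear_Blinfun_apply bounded_bilinear.prod_right.rep_eq[OF bb])
qed

text \<open>
  A functional is controlled by its values on elementary tensors: the projective norm is the infimum of
  \<open>\<Sum> norm x * norm y\<close> over all representations, and the algebraic tensors are dense in the
  completion.
\<close>

lemma norm_operator_of: "norm (operator_of f) = norm f"
proof (rule antisym)
  show "norm (operator_of f) \<le> norm f"
  proof (intro norm_blinfun_bound)
    show "norm (blinfun_apply (blinfun_apply (operator_of f) x) y) \<le> norm f * norm x * norm y" for x y
    proof -
      have "norm (of_alg_tensor (x \<otimes>\<^sub>a y)) \<le> norm x * norm y"
        using proj_norm_le[of "x \<otimes>\<^sub>a y" "[(x, y)]"] by (simp add: norm_of_alg_tensor)
      then have "norm f * norm (of_alg_tensor (x \<otimes>\<^sub>a y)) \<le> norm f * (norm x * norm y)"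
        by (intro mult_left_mono) auto
      then show ?thesis
        using norm_blinfun[of f "of_alg_tensor (x \<otimes>\<^sub>a y)"] by (simp add: operator_of_apply mult.assoc)
    qed
  qed auto
next
  let ?M = "norm (operator_of f)"
  have alg: "\<bar>blinfun_apply f (of_alg_tensor w)\<bar> \<le> ?M * proj_norm w" for w
  proof (rule field_le_epsilon)
    fix e :: real assume "e > 0"
    have e': "e / (?M + 1) > 0" using \<open>e > 0\<close> by (simp add: add_nonneg_pos)
    obtain us where us: "w = (\<Sum>(x,y)\<leftarrow>us. x \<otimes>\<^sub>a y)" "(\<Sum>(x,y)\<leftarrow>us. norm x * norm y) < proj_norm w + e / (?M + 1)"
      using proj_norm_approx[OF e'] by metis
    have elem: "\<bar>blinfun_apply f (of_alg_tensor (x \<otimes>\<^sub>a y))\<bar> \<le> ?M * (norm x * norm y)" for x y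
    proof -
      have "\<bar>blinfun_apply (blinfun_apply (operator_of f) x) y\<bar> \<le> norm (blinfun_apply (operator_of f) x) * norm y"
        using norm_blinfun[of "blinfun_apply (operator_of f) x" y] by simp
      also have "\<dots> \<le> ?M * norm x * norm y" by (intro mult_right_mono norm_blinfun) auto
      finally show ?thesis by (simp add: operator_of_apply mult.assoc)
    qed
    have "\<bar>blinfun_apply f (of_alg_tensor (\<Sum>(x,y)\<leftarrow>us. x \<otimes>\<^sub>a y))\<bar> \<le> ?M * (\<Sum>(x,y)\<leftarrow>us. norm x * norm y)"
    proof (induction us)
      case Nil
      then show ?case by (simp add: linear_0[OF linear_of_alg_tensor])
    next
      case (Cons u us)
      obtain x y where "u = (x, y)" by force
      then show ?case
        using Cons elem[of x y] by (simp add: linear_add[OF linear_of_alg_tensor] blinfun.add_right distrib_left)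
    qed
    also have "\<dots> \<le> ?M * (proj_norm w + e / (?M + 1))"
      using us(2) by (intro mult_left_mono) auto
    also have "\<dots> \<le> ?M * proj_norm w + e"
      using \<open>e > 0\<close> by (simp add: field_simps add_nonneg_pos add_pos_nonneg)
    finally show "\<bar>blinfun_apply f (of_alg_tensor w)\<bar> \<le> ?M * proj_norm w + e" using us(1) by simp
  qed
  show "norm f \<le> ?M"
  proof (rule norm_blinfun_bound)
    fix z
    show "norm (blinfun_apply f z) \<le> ?M * norm z"
    proof (rule field_le_epsilon)
      fix e :: real assume "e > 0"
      define \<delta> where "\<delta> = e / (norm f + ?M + 1)"
      have pos: "norm f + ?M + 1 > 0" by (simp add: add_nonneg_pos)
      then have \<delta>: "\<delta> > 0" using \<open>e > 0\<close> by (simp add: \<delta>_def)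
      obtain w where w: "norm (z - of_alg_tensor w) < \<delta>" using of_alg_tensor_dense[OF \<delta>] by blast
      have "norm (blinfun_apply f z) \<le> norm (blinfun_apply f (z - of_alg_tensor w)) + norm (blinfun_apply f (of_alg_tensor w))"
        using norm_triangle_ineq[of "blinfun_apply f (z - of_alg_tensor w)" "blinfun_apply f (of_alg_tensor w)"]
        by (simp add: blinfun.diff_right)
      also have "\<dots> \<le> norm f * norm (z - of_alg_tensor w) + ?M * proj_norm w"
        using alg[of w] by (intro add_mono norm_blinfun) simp
      also have "\<dots> \<le> norm f * \<delta> + ?M * (norm z + \<delta>)"
      proof (intro add_mono mult_left_mono)
        have "norm (of_alg_tensor w) \<le> norm z + norm (z - of_alg_tensor w)"
          by (metis norm_minus_commute norm_triangle_sub)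
        then show "proj_norm w \<le> norm z + \<delta>" using w by (simp add: norm_of_alg_tensor)
      qed (use w in auto)
      also have "\<dots> \<le> ?M * norm z + (norm f + ?M + 1) * \<delta>" using \<delta> by (simp add: algebra_simps)
      also have "(norm f + ?M + 1) * \<delta> = e" using pos by (simp add: \<delta>_def)
      finally show "norm (blinfun_apply f z) \<le> ?M * norm z + e" .
    qed
  qed auto
qed

lemma operator_of_diff: "operator_of (f - g) = operator_of f - operator_of g"
  by (intro blinfun_eqI) (simp add: operator_of_apply blinfun.diff_left)

section \<open>The projective tensor product of \<open>\<ell>\<^sub>p\<close> with a finite-dimensional space\<close>

theorem theorem3p4:
  fixes p q :: real
    and I :: "'i set"
    and coord :: "'x::banach \<Rightarrow> 'i \<Rightarrow> real"
  assumes "2 < p"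
    and "infinite I"
    and "is_lp_space p I coord"
    and "finite_dimensional TYPE('y::banach)"
    and "2 \<le> q" and "q < p"
    and "convexity_of_power_type TYPE('y \<Rightarrow>\<^sub>L real) q"
  shows "ssd_norm TYPE(('x, 'y) proj_tensor) \<and> weak_star_kadec_klee TYPE(('x, 'y) proj_tensor)"
proof -
  have KK: "((\<lambda>g. norm (g - f)) \<longlongrightarrow> 0) F"
    if ev: "\<forall>\<^sub>F g in F. g \<in> sphere 0 1" and f: "f \<in> sphere 0 1"
      and lim: "limitin weak_star_topology (\<lambda>g. g) f F"
    for f :: "('x, 'y) proj_tensor \<Rightarrow>\<^sub>L real" and F
  proof -
    have "(operator_of \<longlongrightarrow> operator_of f) F"
    proof (rule operators_from_lp_kadec_klee[OF assms(3)])
      show "1 \<le> p" "0 < q" "q < p" using assms by auto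
      show "convexity_of_power_type TYPE('y \<Rightarrow>\<^sub>L real) q" by fact
      show "\<forall>\<^sub>F g in F. norm (operator_of g) \<le> 1"
        using ev by eventually_elim (simp add: norm_operator_of)
      show "norm (operator_of f) = 1" using f by (simp add: norm_operator_of)
      show "((\<lambda>g. blinfun_apply (operator_of g) x) \<longlongrightarrow> blinfun_apply (operator_of f) x) F" for x
        using lim unfolding limitin_weak_star_iff
        by (intro tendsto_functional_if_pointwise[OF assms(4)]) (simp add: operator_of_apply)
    qed
    then have "((\<lambda>g. norm (operator_of g - operator_of f)) \<longlongrightarrow> 0) F"
      by (intro tendsto_norm_zero LIM_zero)
    then show ?thesis by (simp add: norm_operator_of flip: operator_of_diff)
  qed
  then have "weak_star_kadec_klee TYPE(('x, 'y) proj_tensor)"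
    unfolding weak_star_kadec_klee_def by blast
  then show ?thesis using ssd_norm_if_weak_star_kadec_klee by blast
qed

end
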